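(* Suppose that $B\in\mathbb{R}^{N\times 2N}$ satisfies the well-posedness condition (see context), and let the associated operators $\mathcal{T},\mathcal{R}_j\in\Pi_2$ for $j\in\{0,\dots,N-1\}$ be as defined in the context. Let further $\alpha_k\in L_\infty[a,b]$ for $k\in\{0,\dots,N\}$, and $\beta_{ij}\in L_\infty[a,b]$ for $i\in\{0,\dots,N-1\}$, $j\in\{0,\dots,i\}$, and define the operators $\mathcal{A}\in\Pi_3$ and $\mathcal{B}\in\Pi_{2^2}$ as $$\mathcal{A}=\sum_{i=0}^{N}\mathcal{M}_{\alpha_i}\mathcal{R}_i,\qquad \mathcal{B}=\sum_{i=0}^{N-1}\sum_{j=0}^{i}\mathcal{M}_{\beta_{ij}}[\mathcal{R}_i\otimes\mathcal{R}_j],$$ where $\mathcal{R}_N=I\in\Pi_3$. Then, $\mathbf{v}$ is a classical solution to the quadratic PIE defined by $\{\mathcal{T},[\mathcal{A},\mathcal{B}]\}$ with initial state $\mathbf{v}_0$ if and only if $\mathcal{T}\mathbf{v}$ is a classical solution to the quadratic PDE defined by $\{B,[\alpha,\beta]\}$ with initial state $\mathcal{T}\mathbf{v}_0$. Conversely, $\mathbf{u}$ is a classical solution to the quadratic PDE defined by $\{B,[\alpha,\beta]\}$ with initial state $\mathbf{u}_0$ if and only if $\partial_s^N\mathbf{u}$ is a classical solution to the quadratic PIE defined by $\{\mathcal{T},[\mathcal{A},\mathcal{B}]\}$ with initial state $\partial_s^N\mathbf{u}_0$.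
   Context: $N$ is a positive integer (the order of the PDE), $[a,b]\subset\mathbb{R}$ is an interval, and all functions are real-valued. $L_2$ and $L_\infty$ denote square-integrable and bounded functions, respectively. $H_N[a,b]$ is the Sobolev space of $\mathbf{u}\in L_2[a,b]$ with $\partial_s^k\mathbf{u}\in L_2[a,b]$ for all $k\le N$. Boundary conditions: for $B\in\mathbb{R}^{N\times 2N}$, $$X_B:=\Big\{\mathbf{u}\in H_N[a,b] : B\,\big(\mathbf{u}(a),\partial_s\mathbf{u}(a),\dots,\partial_s^{N-1}\mathbf{u}(a),\mathbf{u}(b),\partial_s\mathbf{u}(b),\dots,\partial_s^{N-1}\mathbf{u}(b)\big)^T=0\Big\}.$$ The well-posedness condition on $B$ is that the only polynomial in $s$ of degree at most $N-1$ belonging to $X_B$ is the zero polynomial; equivalently, $\partial_s^N:X_B\to L_2[a,b]$ is a bijection. PI operators: $\Pi_3$ is the set of operators on $L_2[a,b]$ of the form $(\mathcal{R}\mathbf{v})(s)=R_0(s)\mathbf{v}(s)+\int_a^s R_1(s,\theta)\mathbf{v}(\theta)d\theta+\int_s^b R_2(s,\theta)\mathbf{v}(\theta)d\theta$ with $R_0\in L_\infty[a,b]$ and $R_1,R_2\in L_2[[a,b]^2]$; $\Pi_2$ is the subset with $R_0=0$. $\Pi_{2^2}$ is the set of operators acting on $\mathbf{w}\in L_2[[a,b]^2]$ of the form $$(\mathcal{Q}\mathbf{w})(s)=\int_a^s\!\int_a^\theta Q_1(s,\theta,\eta)\mathbf{w}(\theta,\eta)d\eta d\theta+\int_s^b\!\int_a^s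 Q_2(s,\theta,\eta)\mathbf{w}(\theta,\eta)d\eta d\theta+\int_s^b\!\int_s^\theta Q_3(s,\theta,\eta)\mathbf{w}(\theta,\eta)d\eta d\theta$$ with $Q_1,Q_2,Q_3\in L_2[[a,b]^3]$. For $B$ satisfying the well-posedness condition, $\mathcal{T}\in\Pi_2$ is the inverse $L_2[a,b]\to X_B$ of $\partial_s^N:X_B\to L_2[a,b]$, and $\mathcal{R}_j:=\partial_s^j\circ\mathcal{T}\in\Pi_2$ for $j\in\{0,\dots,N-1\}$. Thus $\mathbf{u}=\mathcal{T}[\partial_s^N\mathbf{u}]$ and $\partial_s^j\mathbf{u}=\mathcal{R}_j[\partial_s^N\mathbf{u}]$ for all $\mathbf{u}\in X_B$, and $\mathbf{v}=\partial_s^N[\mathcal{T}\mathbf{v}]$ and $\mathcal{R}_j\mathbf{v}=\partial_s^j[\mathcal{T}\mathbf{v}]$ for all $\mathbf{v}\in L_2[a,b]$. Tensor products: $[\mathbf{v}\otimes\mathbf{v}](\theta,\eta)=\mathbf{v}(\theta)\mathbf{v}(\eta)$. For $\mathcal{S},\mathcal{R}\in\Pi_2$ with kernels $S_1,S_2$ and $R_1,R_2$, $\mathcal{S}\otimes\mathcal{R}\in\Pi_{2^2}$ is the operator of the form above with $Q_1(s,\theta,\eta)=S_1(s,\theta)R_1(s,\eta)+S_1(s,\eta)R_1(s,\theta)$, $Q_2(s,\theta,\eta)=S_2(s,\theta)R_1(s,\eta)+S_1(s,\eta)R_2(s,\theta)$, $Q_3(s,\theta,\eta)=S_2(s,\theta)R_2(s,\eta)+S_2(s,\eta)R_2(s,\theta)$.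 For $c\in L_\infty[a,b]$, $\mathcal{M}_c$ is the multiplier operator $(\mathcal{M}_c\mathbf{v})(s)=c(s)\mathbf{v}(s)$. Classical solution to the PDE: for a given initial state $\mathbf{u}_0\in X_B$, $\mathbf{u}$ is a classical solution to the quadratic PDE defined by $\{B,[\alpha,\beta]\}$ if $\mathbf{u}$ is Fréchet differentiable, $\mathbf{u}(0)=\mathbf{u}_0$, and for all $t\ge0$, $\mathbf{u}(t)\in X_B$ and $\mathbf{u}(t)$ satisfies $$\partial_t\mathbf{u}(t,s)=\sum_{i=0}^N\alpha_i(s)\partial_s^i\mathbf{u}(t,s)+\sum_{i=0}^{N-1}\sum_{j=0}^i\beta_{ij}(s)\,\partial_s^i\mathbf{u}(t,s)\,\partial_s^j\mathbf{u}(t,s),\qquad s\in[a,b].$$ Classical solution to the PIE: for a given initial state $\mathbf{v}_0\in L_2[a,b]$, $\mathbf{v}$ (with $\mathbf{v}(t)\in L_2[a,b]$) is a classical solution to the quadratic PIE defined by $\{\mathcal{T},[\mathcal{A},\mathcal{B}]\}$ if $\mathbf{v}$ is Fréchet differentiable, $\mathbf{v}(0)=\mathbf{v}_0$, and for all $t\ge0$, $\partial_t\mathcal{T}\mathbf{v}(t)=\mathcal{A}\mathbf{v}(t)+\mathcal{B}[\mathbf{v}(t)\otimes\mathbf{v}(t)]$.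
   Formalization: In the second equivalence u(t) is assumed to lie in X_B for all t ≥ 0 (otherwise ∂_s^N u does not determine u and the claim fails), and Fréchet differentiability of a PDE solution is meant in the H_N norm (in the L_2 norm the claim fails). *)

theory Defs
  imports "HOL-Analysis.Analysis" "HOL-Computational_Algebra.Polynomial"
    "Jordan_Normal_Form.Matrix"
begin

text \<open>
  Elements of Lebesgue and Sobolev spaces are represented by functions, and equality of such
  elements is equality almost everywhere on the underlying set.
\<close>

definition L2 :: "'a::euclidean_space set \<Rightarrow> ('a \<Rightarrow> real) set" where
  "L2 S = {f. f \<in> borel_measurable (lebesgue_on S) \<and>
              integrable (lebesgue_on S) (\<lambda>x. (f x)\<^sup>2)}"

definition Linf :: "'a::euclidean_space set \<Rightarrow> ('a \<Rightarrow> real) set" where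
  "Linf S = {f. f \<in> borel_measurable (lebesgue_on S) \<and>
                (\<exists>C. AE x in lebesgue_on S. \<bar>f x\<bar> \<le> C)}"

definition L2_norm :: "real \<Rightarrow> real \<Rightarrow> (real \<Rightarrow> real) \<Rightarrow> real" where
  "L2_norm a b f = sqrt (LINT x|lebesgue_on {a..b}. (f x)\<^sup>2)"

definition ae_eq :: "real \<Rightarrow> real \<Rightarrow> (real \<Rightarrow> real) \<Rightarrow> (real \<Rightarrow> real) \<Rightarrow> bool" where
  "ae_eq a b f g \<longleftrightarrow> (AE x in lebesgue_on {a..b}. f x = g x)"


subsection \<open>Weak derivatives and Sobolev spaces on an interval\<close>

text \<open>
  Test functions are continuously differentiable with compact support in the open interval;
  \<open>\<phi>'\<close> is the derivative of \<open>\<phi>\<close>.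
\<close>

definition test_function :: "real \<Rightarrow> real \<Rightarrow> (real \<Rightarrow> real) \<Rightarrow> (real \<Rightarrow> real) \<Rightarrow> bool" where
  "test_function a b \<phi> \<phi>' \<longleftrightarrow>
     (\<forall>x. (\<phi> has_real_derivative \<phi>' x) (at x)) \<and> continuous_on UNIV \<phi>' \<and>
     (\<exists>c d. a < c \<and> c \<le> d \<and> d < b \<and> (\<forall>x. x \<notin> {c..d} \<longrightarrow> \<phi> x = 0))"

definition is_weak_deriv :: "real \<Rightarrow> real \<Rightarrow> (real \<Rightarrow> real) \<Rightarrow> (real \<Rightarrow> real) \<Rightarrow> bool" where
  "is_weak_deriv a b u g \<longleftrightarrow>
     (\<forall>\<phi> \<phi>'. test_function a b \<phi> \<phi>' \<longrightarrow>
        (LINT x|lebesgue_on {a..b}. u x * \<phi>' x) = - (LINT x|lebesgue_on {a..b}. g x * \<phi> x))"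

definition weak_deriv :: "real \<Rightarrow> real \<Rightarrow> (real \<Rightarrow> real) \<Rightarrow> (real \<Rightarrow> real)" where
  "weak_deriv a b u = (SOME g. g \<in> L2 {a..b} \<and> is_weak_deriv a b u g)"

text \<open>
  \<open>dds a b k u\<close> is the \<open>k\<close>-th weak derivative of \<open>u\<close>. It is meaningful, and then
  unique almost everywhere, when \<open>u \<in> Sobolev a b k\<close>.
\<close>

definition dds :: "real \<Rightarrow> real \<Rightarrow> nat \<Rightarrow> (real \<Rightarrow> real) \<Rightarrow> (real \<Rightarrow> real)" where
  "dds a b k = weak_deriv a b ^^ k"

definition Sobolev :: "real \<Rightarrow> real \<Rightarrow> nat \<Rightarrow> (real \<Rightarrow> real) set" where
  "Sobolev a b N = {u. u \<in> L2 {a..b} \<and>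
     (\<forall>k<N. \<exists>g. g \<in> L2 {a..b} \<and> is_weak_deriv a b (dds a b k u) g)}"

definition Sobolev_norm :: "real \<Rightarrow> real \<Rightarrow> nat \<Rightarrow> (real \<Rightarrow> real) \<Rightarrow> real" where
  "Sobolev_norm a b N u = sqrt (\<Sum>k\<le>N. (L2_norm a b (dds a b k u))\<^sup>2)"

text \<open>Point values of a Sobolev function are those of its continuous representative.\<close>

definition cont_rep :: "real \<Rightarrow> real \<Rightarrow> (real \<Rightarrow> real) \<Rightarrow> (real \<Rightarrow> real)" where
  "cont_rep a b f = (SOME g. continuous_on {a..b} g \<and> ae_eq a b g f)"

definition boundary_values :: "real \<Rightarrow> real \<Rightarrow> nat \<Rightarrow> (real \<Rightarrow> real) \<Rightarrow> real Matrix.vec" where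
  "boundary_values a b N u = Matrix.vec (2 * N)
     (\<lambda>i. if i < N then cont_rep a b (dds a b i u) a
          else cont_rep a b (dds a b (i - N) u) b)"

definition bc_space :: "real \<Rightarrow> real \<Rightarrow> nat \<Rightarrow> real mat \<Rightarrow> (real \<Rightarrow> real) set" where
  "bc_space a b N B = {u \<in> Sobolev a b N. B *\<^sub>v boundary_values a b N u = 0\<^sub>v N}"

definition well_posed :: "real \<Rightarrow> real \<Rightarrow> nat \<Rightarrow> real mat \<Rightarrow> bool" where
  "well_posed a b N B \<longleftrightarrow>
     (\<forall>p :: real poly. degree p \<le> N - 1 \<and> poly p \<in> bc_space a b N B \<longrightarrow> p = 0)"


subsection \<open>Partial integral operators\<close>

definition pi3_op :: "real \<Rightarrow> real \<Rightarrow> (real \<Rightarrow> real) \<Rightarrow> (real \<times> real \<Rightarrow> real) \<Rightarrow>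
    (real \<times> real \<Rightarrow> real) \<Rightarrow> (real \<Rightarrow> real) \<Rightarrow> (real \<Rightarrow> real)" where
  "pi3_op a b R0 R1 R2 v = (\<lambda>s. R0 s * v s
     + (LINT \<theta>|lebesgue_on {a..s}. R1 (s, \<theta>) * v \<theta>)
     + (LINT \<theta>|lebesgue_on {s..b}. R2 (s, \<theta>) * v \<theta>))"

definition pi22_op :: "real \<Rightarrow> real \<Rightarrow> (real \<times> real \<times> real \<Rightarrow> real) \<Rightarrow>
    (real \<times> real \<times> real \<Rightarrow> real) \<Rightarrow> (real \<times> real \<times> real \<Rightarrow> real) \<Rightarrow>
    (real \<times> real \<Rightarrow> real) \<Rightarrow> (real \<Rightarrow> real)" where
  "pi22_op a b Q1 Q2 Q3 w = (\<lambda>s.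
     (LINT \<theta>|lebesgue_on {a..s}. LINT \<eta>|lebesgue_on {a..\<theta>}. Q1 (s, \<theta>, \<eta>) * w (\<theta>, \<eta>))
   + (LINT \<theta>|lebesgue_on {s..b}. LINT \<eta>|lebesgue_on {a..s}. Q2 (s, \<theta>, \<eta>) * w (\<theta>, \<eta>))
   + (LINT \<theta>|lebesgue_on {s..b}. LINT \<eta>|lebesgue_on {s..\<theta>}. Q3 (s, \<theta>, \<eta>) * w (\<theta>, \<eta>)))"

text \<open>
  \<open>R\<close> is, as an operator on \<open>L2 {a..b}\<close>, the element of \<open>\<Pi>\<^sub>2\<close>
  with kernels \<open>R1\<close>, \<open>R2\<close>. The kernel \<open>R1\<close> only matters for
  \<open>\<theta> \<le> s\<close>, and \<open>R2\<close> only for \<open>s \<le> \<theta>\<close>; there they are determined by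
  \<open>R\<close> almost everywhere, so \<open>tensor_op\<close> below does not depend on the choice of kernels.
\<close>

definition has_pi2_kernels :: "real \<Rightarrow> real \<Rightarrow> ((real \<Rightarrow> real) \<Rightarrow> (real \<Rightarrow> real)) \<Rightarrow>
    (real \<times> real \<Rightarrow> real) \<Rightarrow> (real \<times> real \<Rightarrow> real) \<Rightarrow> bool" where
  "has_pi2_kernels a b R R1 R2 \<longleftrightarrow>
     R1 \<in> L2 ({a..b} \<times> {a..b}) \<and> R2 \<in> L2 ({a..b} \<times> {a..b}) \<and>
     (\<forall>v \<in> L2 {a..b}. ae_eq a b (R v) (pi3_op a b (\<lambda>_. 0) R1 R2 v))"

definition pi2_kernels :: "real \<Rightarrow> real \<Rightarrow> ((real \<Rightarrow> real) \<Rightarrow> (real \<Rightarrow> real)) \<Rightarrow>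
    (real \<times> real \<Rightarrow> real) \<times> (real \<times> real \<Rightarrow> real)" where
  "pi2_kernels a b R = (SOME (R1, R2). has_pi2_kernels a b R R1 R2)"

definition tensor_op :: "real \<Rightarrow> real \<Rightarrow> ((real \<Rightarrow> real) \<Rightarrow> (real \<Rightarrow> real)) \<Rightarrow>
    ((real \<Rightarrow> real) \<Rightarrow> (real \<Rightarrow> real)) \<Rightarrow> (real \<times> real \<Rightarrow> real) \<Rightarrow> (real \<Rightarrow> real)" where
  "tensor_op a b S R =
     (let (S1, S2) = pi2_kernels a b S; (R1, R2) = pi2_kernels a b R in
      pi22_op a b
        (\<lambda>(s, \<theta>, \<eta>). S1 (s, \<theta>) * R1 (s, \<eta>) + S1 (s, \<eta>) * R1 (s, \<theta>))
        (\<lambda>(s, \<theta>, \<eta>). S2 (s, \<theta>) * R1 (s, \<eta>) + S1 (s, \<eta>) * R2 (s, \<theta>))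
        (\<lambda>(s, \<theta>, \<eta>). S2 (s, \<theta>) * R2 (s, \<eta>) + S2 (s, \<eta>) * R2 (s, \<theta>)))"

definition tensor_sq :: "(real \<Rightarrow> real) \<Rightarrow> (real \<times> real \<Rightarrow> real)" where
  "tensor_sq v = (\<lambda>(\<theta>, \<eta>). v \<theta> * v \<eta>)"

definition mult_op :: "(real \<Rightarrow> real) \<Rightarrow> ('v \<Rightarrow> real \<Rightarrow> real) \<Rightarrow> ('v \<Rightarrow> real \<Rightarrow> real)" where
  "mult_op c R v = (\<lambda>s. c s * R v s)"


subsection \<open>The operators of the PIE associated with a PDE\<close>

text \<open>The inverse of \<open>dds a b N\<close> on \<open>bc_space a b N B\<close>.\<close>

definition T_op :: "real \<Rightarrow> real \<Rightarrow> nat \<Rightarrow> real mat \<Rightarrow> (real \<Rightarrow> real) \<Rightarrow> (real \<Rightarrow> real)" where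
  "T_op a b N B v = (SOME u. u \<in> bc_space a b N B \<and> ae_eq a b (dds a b N u) v)"

definition R_op :: "real \<Rightarrow> real \<Rightarrow> nat \<Rightarrow> real mat \<Rightarrow> nat \<Rightarrow> (real \<Rightarrow> real) \<Rightarrow> (real \<Rightarrow> real)" where
  "R_op a b N B j = (if j = N then id else dds a b j \<circ> T_op a b N B)"

definition A_op :: "real \<Rightarrow> real \<Rightarrow> nat \<Rightarrow> real mat \<Rightarrow> (nat \<Rightarrow> real \<Rightarrow> real) \<Rightarrow>
    (real \<Rightarrow> real) \<Rightarrow> (real \<Rightarrow> real)" where
  "A_op a b N B \<alpha> v = (\<lambda>s. \<Sum>i\<le>N. mult_op (\<alpha> i) (R_op a b N B i) v s)"

definition B_op :: "real \<Rightarrow> real \<Rightarrow> nat \<Rightarrow> real mat \<Rightarrow> (nat \<Rightarrow> nat \<Rightarrow> real \<Rightarrow> real) \<Rightarrow>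
    (real \<times> real \<Rightarrow> real) \<Rightarrow> (real \<Rightarrow> real)" where
  "B_op a b N B \<beta> w = (\<lambda>s. \<Sum>i<N. \<Sum>j\<le>i.
     mult_op (\<beta> i j) (tensor_op a b (R_op a b N B i) (R_op a b N B j)) w s)"


subsection \<open>Classical solutions\<close>

text \<open>
  \<open>w\<close> is the Frechet derivative at time \<open>t\<close> of a curve \<open>f\<close> defined for
  times \<open>\<tau> \<ge> 0\<close>, in the (semi)normed function space \<open>X\<close> with norm \<open>nrm\<close>. As for
  \<^const>\<open>has_derivative\<close>, except that the space is not a type.
\<close>

definition has_frechet_deriv :: "(real \<Rightarrow> real) set \<Rightarrow> ((real \<Rightarrow> real) \<Rightarrow> real) \<Rightarrow>
    (real \<Rightarrow> real \<Rightarrow> real) \<Rightarrow> (real \<Rightarrow> real) \<Rightarrow> real \<Rightarrow> bool" where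
  "has_frechet_deriv X nrm f w t \<longleftrightarrow> w \<in> X \<and>
     ((\<lambda>\<tau>. nrm (\<lambda>s. f \<tau> s - f t s - (\<tau> - t) * w s) / \<bar>\<tau> - t\<bar>) \<longlongrightarrow> 0) (at t within {0..})"

definition pde_solution :: "real \<Rightarrow> real \<Rightarrow> nat \<Rightarrow> real mat \<Rightarrow> (nat \<Rightarrow> real \<Rightarrow> real) \<Rightarrow>
    (nat \<Rightarrow> nat \<Rightarrow> real \<Rightarrow> real) \<Rightarrow> (real \<Rightarrow> real \<Rightarrow> real) \<Rightarrow> (real \<Rightarrow> real) \<Rightarrow> bool" where
  "pde_solution a b N B \<alpha> \<beta> u u0 \<longleftrightarrow>
     ae_eq a b (u 0) u0 \<and>
     (\<forall>t\<ge>0. u t \<in> bc_space a b N B \<and>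
       (\<exists>w. has_frechet_deriv (Sobolev a b N) (Sobolev_norm a b N) u w t \<and>
            ae_eq a b w (\<lambda>s. (\<Sum>i\<le>N. \<alpha> i s * dds a b i (u t) s)
              + (\<Sum>i<N. \<Sum>j\<le>i. \<beta> i j s * dds a b i (u t) s * dds a b j (u t) s))))"

definition pie_solution :: "real \<Rightarrow> real \<Rightarrow> ((real \<Rightarrow> real) \<Rightarrow> (real \<Rightarrow> real)) \<Rightarrow>
    ((real \<Rightarrow> real) \<Rightarrow> (real \<Rightarrow> real)) \<Rightarrow> ((real \<times> real \<Rightarrow> real) \<Rightarrow> (real \<Rightarrow> real)) \<Rightarrow>
    (real \<Rightarrow> real \<Rightarrow> real) \<Rightarrow> (real \<Rightarrow> real) \<Rightarrow> bool" where
  "pie_solution a b T A Q v v0 \<longleftrightarrow>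
     ae_eq a b (v 0) v0 \<and>
     (\<forall>t\<ge>0. v t \<in> L2 {a..b} \<and>
       (\<exists>w. has_frechet_deriv (L2 {a..b}) (L2_norm a b) v w t) \<and>
       has_frechet_deriv (L2 {a..b}) (L2_norm a b) (\<lambda>\<tau>. T (v \<tau>))
         (\<lambda>s. A (v t) s + Q (tensor_sq (v t)) s) t)"

end

theory Submission imports Defs "Jordan_Normal_Form.Determinant" begin

text \<open>
  The operator \<open>T = T_op a b N B\<close> inverts the highest derivative on the functions that satisfy the boundary
  conditions, and it is linear and bounded from \<open>L2\<close> into the Sobolev space. So \<open>v \<mapsto> T v\<close> and
  \<open>u \<mapsto> dds a b N u\<close> are mutually inverse bounded linear maps up to null sets, and each carries
  Frechet differentiable curves to Frechet differentiable curves. Under this correspondence the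
  right hand sides agree: \<open>R_op a b N B i v\<close> is by definition the \<open>i\<close>-th derivative of \<open>T v\<close> for
  \<open>i < N\<close> and agrees a.e. with it for \<open>i = N\<close>, and a tensor product applied to \<open>v \<otimes> v\<close> is the product
  of its two factors applied to \<open>v\<close>. A PIE solution carries two derivatives, that of \<open>v\<close> and that
  of \<open>T v\<close>; the second is \<open>T\<close> of the first because derivatives in \<open>L2\<close> are unique.

  Three facts carry this.

  First, a weakly differentiable function is a.e. a constant plus the integral of its weak
  derivative (\<open>weak_deriv_imp_primitive\<close>, from the lemma of du Bois-Reymond,
  \<open>weak_deriv_0_imp_const\<close>). Hence a function with vanishing \<open>N\<close>-th derivative is a polynomial of
  degree less than \<open>N\<close>, and well-posedness makes \<open>dds a b N\<close> injective under the boundary conditions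
  (\<open>bc_space_unique\<close>).

  Second, well-posedness also makes an \<open>N \<times> N\<close> matrix invertible, so that the \<open>N\<close>-fold integral of
  \<open>v\<close> can be corrected by a polynomial to meet the boundary conditions (\<open>boundary_correction\<close>,
  \<open>T_op_formula\<close>). By Cauchy's formula for repeated integration both parts are integrals of \<open>v\<close>
  against continuous kernels (\<open>dds_T_op_kernels\<close>), which gives boundedness of \<open>T\<close>
  (\<open>T_op_bounded\<close>) and shows that the derivatives of \<open>T\<close> of order less than \<open>N\<close> are partial integral
  operators.

  Third, for almost every \<open>s\<close> the sections at \<open>s\<close> of any square-integrable kernels are
  square-integrable, and then Fubini turns the three double integrals of the tensor product into
  a product of single integrals (\<open>tensor_op_tensor_sq\<close>). This holds for whichever kernels represent
  the two operators.
\<close>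

section \<open>Square-integrable functions up to null sets\<close>

lemma ae_eq_refl [simp]: "ae_eq a b f f"
  by (simp add: ae_eq_def)

lemma ae_eq_sym: "ae_eq a b f g \<Longrightarrow> ae_eq a b g f"
  unfolding ae_eq_def by (auto elim: eventually_mono)

lemma ae_eq_trans [trans]: "ae_eq a b f g \<Longrightarrow> ae_eq a b g h \<Longrightarrow> ae_eq a b f h"
  unfolding ae_eq_def by (erule (1) eventually_elim2) auto

lemma ae_eqI: "(\<And>x. x \<in> {a..b} \<Longrightarrow> f x = g x) \<Longrightarrow> ae_eq a b f g"
  unfolding ae_eq_def by (intro AE_I2) auto

lemma ae_eq_lift: "ae_eq a b f g \<Longrightarrow> ae_eq a b (\<lambda>x. h x (f x)) (\<lambda>x. h x (g x))"
  unfolding ae_eq_def by (erule eventually_mono) auto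

lemma ae_eq_lift2:
  "ae_eq a b f g \<Longrightarrow> ae_eq a b f' g' \<Longrightarrow> ae_eq a b (\<lambda>x. h x (f x) (f' x)) (\<lambda>x. h x (g x) (g' x))"
  unfolding ae_eq_def by (erule (1) eventually_elim2) auto

lemma ae_eq_sum:
  assumes "\<And>i. i \<in> I \<Longrightarrow> ae_eq a b (f i) (g i)"
  shows "ae_eq a b (\<lambda>x. \<Sum>i\<in>I. f i x) (\<lambda>x. \<Sum>i\<in>I. g i x)"
  using assms
proof (induction I rule: infinite_finite_induct)
  case (insert i I)
  then show ?case
    using ae_eq_lift2[of a b "f i" "g i" "\<lambda>x. \<Sum>i\<in>I. f i x" "\<lambda>x. \<Sum>i\<in>I. g i x" "\<lambda>_ y z. y + z"] by simp
qed auto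

text \<open>Lebesgue measure is complete, so changing a function on a null set preserves measurability.\<close>

lemma measurable_ae_cong:
  fixes f g :: "'a::euclidean_space \<Rightarrow> real"
  assumes "AE x in lebesgue_on S. f x = g x" and S: "S \<in> sets lebesgue"
    and f: "f \<in> borel_measurable (lebesgue_on S)"
  shows "g \<in> borel_measurable (lebesgue_on S)"
proof -
  have "AE x in lebesgue. (if x \<in> S then f x else 0) = (if x \<in> S then g x else 0)"
    using assms(1) S by (auto simp: AE_restrict_space_iff elim: eventually_mono)
  from borel_measurable_AE[OF borel_measurable_if_I[OF f S] this] show ?thesis
    by (rule borel_measurable_if_D)
qed

lemma measurable_ae_eq:
  assumes "ae_eq a b f g"
  shows "f \<in> borel_measurable (lebesgue_on {a..b}) \<longleftrightarrow> g \<in> borel_measurable (lebesgue_on {a..b})"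
proof
  assume "f \<in> borel_measurable (lebesgue_on {a..b})"
  then show "g \<in> borel_measurable (lebesgue_on {a..b})"
    using assms by (intro measurable_ae_cong[of f g "{a..b}"]) (simp_all add: ae_eq_def)
next
  assume "g \<in> borel_measurable (lebesgue_on {a..b})"
  then show "f \<in> borel_measurable (lebesgue_on {a..b})"
    using ae_eq_sym[OF assms] by (intro measurable_ae_cong[of g f "{a..b}"]) (simp_all add: ae_eq_def)
qed

lemma integrable_ae_eq:
  assumes "ae_eq a b f g"
  shows "integrable (lebesgue_on {a..b}) f \<longleftrightarrow> integrable (lebesgue_on {a..b}) g"
proof -
  have "integrable (lebesgue_on {a..b}) g" if "ae_eq a b f g" "integrable (lebesgue_on {a..b}) f" for f g
    using that measurable_ae_eq[OF that(1)]
    by (subst integrable_cong_AE[where g = f]) (auto simp: ae_eq_def eq_commute)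
  with assms ae_eq_sym[OF assms] show ?thesis by blast
qed

lemma integral_ae_eq:
  assumes "ae_eq a b f g"
  shows "(LINT x|lebesgue_on {a..b}. f x) = (LINT x|lebesgue_on {a..b}. g x)"
proof (cases "integrable (lebesgue_on {a..b}) f")
  case True
  then show ?thesis
    using assms integrable_ae_eq[OF assms] by (intro integral_cong_AE) (auto simp: ae_eq_def)
next
  case False
  then show ?thesis
    using integrable_ae_eq[OF assms] by (simp add: not_integrable_integral_eq)
qed

lemma L2_ae_eq: "ae_eq a b f g \<Longrightarrow> f \<in> L2 {a..b} \<longleftrightarrow> g \<in> L2 {a..b}"
  using measurable_ae_eq[of a b f g] integrable_ae_eq[OF ae_eq_lift[of a b f g "\<lambda>_ y. y\<^sup>2"]]
  by (auto simp: L2_def)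

lemma L2_norm_ae_eq: "ae_eq a b f g \<Longrightarrow> L2_norm a b f = L2_norm a b g"
  using integral_ae_eq[OF ae_eq_lift[of a b f g "\<lambda>_ y. y\<^sup>2"]] by (simp add: L2_norm_def)

lemma L2_mult_integrable:
  assumes "f \<in> L2 S" "g \<in> L2 S"
  shows "integrable (lebesgue_on S) (\<lambda>x. f x * g x)"
proof (rule Bochner_Integration.integrable_bound)
  show "integrable (lebesgue_on S) (\<lambda>x. (f x)\<^sup>2 + (g x)\<^sup>2)" using assms by (simp add: L2_def)
  show "(\<lambda>x. f x * g x) \<in> borel_measurable (lebesgue_on S)"
    using assms by (auto simp: L2_def intro!: borel_measurable_times)
  have "\<bar>y * z\<bar> \<le> y\<^sup>2 + z\<^sup>2" for y z :: real
  proof -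
    have "2 * \<bar>y * z\<bar> \<le> y\<^sup>2 + z\<^sup>2"
      using sum_squares_bound[of "\<bar>y\<bar>" "\<bar>z\<bar>"] by (simp add: abs_mult)
    moreover have "0 \<le> \<bar>y * z\<bar>" by (rule abs_ge_zero)
    ultimately show ?thesis by linarith
  qed
  then show "AE x in lebesgue_on S. norm (f x * g x) \<le> norm ((f x)\<^sup>2 + (g x)\<^sup>2)"
    by (intro AE_I2) (simp add: abs_mult)
qed

lemma L2_const: "(\<lambda>_. c) \<in> L2 {a..b::real}"
  using finite_measure.integrable_const[OF finite_measure_lebesgue_on[OF lmeasurable_interval(1)], of a b]
  by (simp add: L2_def)

lemma L2_integrable:
  assumes "f \<in> L2 {a..b::real}" shows "integrable (lebesgue_on {a..b}) f"
  using L2_mult_integrable[OF assms L2_const[of 1]] by simp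

lemma L2_lincomb:
  assumes f: "f \<in> L2 S" and g: "g \<in> L2 S"
  shows "(\<lambda>x. c * f x + d * g x) \<in> L2 S"
proof -
  have "integrable (lebesgue_on S) (\<lambda>x. c\<^sup>2 * (f x)\<^sup>2 + d\<^sup>2 * (g x)\<^sup>2 + 2 * c * d * (f x * g x))"
    using f g L2_mult_integrable[OF f g] by (simp add: L2_def)
  moreover have "c\<^sup>2 * (f x)\<^sup>2 + d\<^sup>2 * (g x)\<^sup>2 + 2 * c * d * (f x * g x) = (c * f x + d * g x)\<^sup>2" for x
    by (simp add: power2_eq_square algebra_simps)
  moreover have "(\<lambda>x. c * f x + d * g x) \<in> borel_measurable (lebesgue_on S)"
    using f g by (auto simp: L2_def intro!: borel_measurable_add borel_measurable_times)
  ultimately show ?thesis by (simp add: L2_def)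
qed

lemma L2_diff: "f \<in> L2 S \<Longrightarrow> g \<in> L2 S \<Longrightarrow> (\<lambda>x. f x - g x) \<in> L2 S"
  using L2_lincomb[of f S g 1 "-1"] by simp

lemma L2_cmult: "f \<in> L2 S \<Longrightarrow> (\<lambda>x. c * f x) \<in> L2 S"
  using L2_lincomb[of f S f c 0] by simp

lemma L2_continuous:
  assumes "continuous_on S f" "compact S"
  shows "f \<in> L2 S"
proof -
  have S: "S \<in> sets lebesgue" using assms(2) by (simp add: lmeasurable_compact fmeasurableD)
  have meas: "f \<in> borel_measurable (lebesgue_on S)"
    using assms S by (intro continuous_imp_measurable_on_sets_lebesgue)
  obtain C where C: "\<And>x. x \<in> S \<Longrightarrow> norm (f x) \<le> C"
    using compact_imp_bounded[OF compact_continuous_image[OF assms]] by (auto simp: bounded_iff)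
  have "integrable (lebesgue_on S) (\<lambda>x. (f x)\<^sup>2)"
  proof (rule finite_measure.integrable_const_bound[where B = "C\<^sup>2"])
    show "finite_measure (lebesgue_on S)"
      using assms(2) by (intro finite_measure_lebesgue_on lmeasurable_compact)
    show "AE x in lebesgue_on S. norm ((f x)\<^sup>2) \<le> C\<^sup>2"
      using power_mono[OF C norm_ge_zero, of _ 2] by (intro AE_I2) simp
  qed (use meas in simp)
  with meas show ?thesis by (simp add: L2_def)
qed

lemma L2_norm_nonneg [simp]: "0 \<le> L2_norm a b f"
  by (simp add: L2_norm_def)

lemma L2_norm_cmult: "L2_norm a b (\<lambda>x. c * f x) = \<bar>c\<bar> * L2_norm a b f"
  by (simp add: L2_norm_def power_mult_distrib real_sqrt_mult)

lemma L2_norm_eq_0: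
  assumes "f \<in> L2 {a..b}" "L2_norm a b f = 0"
  shows "ae_eq a b f (\<lambda>_. 0)"
  using assms integral_nonneg_eq_0_iff_AE[of "lebesgue_on {a..b}" "\<lambda>x. (f x)\<^sup>2"]
  by (simp add: L2_def L2_norm_def ae_eq_def)

lemma L2_norm_le_of_bound:
  assumes "f \<in> L2 {a..b}" "AE x in lebesgue_on {a..b}. \<bar>f x\<bar> \<le> C" "0 \<le> C" "a \<le> b"
  shows "L2_norm a b f \<le> sqrt (b - a) * C"
proof -
  have "(LINT x|lebesgue_on {a..b}. (f x)\<^sup>2) \<le> (LINT x|lebesgue_on {a..b}. C\<^sup>2)"
  proof (rule integral_mono_AE)
    show "integrable (lebesgue_on {a..b}) (\<lambda>x. C\<^sup>2)" by (rule L2_integrable[OF L2_const])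
    show "AE x in lebesgue_on {a..b}. (f x)\<^sup>2 \<le> C\<^sup>2"
      using assms(2) by eventually_elim (simp add: abs_le_square_iff[symmetric] \<open>0 \<le> C\<close>)
  qed (use assms(1) in \<open>simp add: L2_def\<close>)
  also have "\<dots> = (b - a) * C\<^sup>2"
    using assms(4) by (simp add: measure_restrict_space)
  finally show ?thesis
    using assms by (simp add: L2_norm_def real_le_lsqrt power_mult_distrib)
qed

text \<open>
  The factor 2 makes the estimate immediate from \<open>(x - y)\<^sup>2 \<le> 2 x\<^sup>2 + 2 y\<^sup>2\<close>, and it is harmless where
  a norm only has to tend to 0.
\<close>

lemma L2_norm_diff_le:
  assumes "f \<in> L2 {a..b}" "g \<in> L2 {a..b}"
  shows "L2_norm a b (\<lambda>x. f x - g x) \<le> 2 * L2_norm a b f + 2 * L2_norm a b g"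
proof -
  let ?I = "\<lambda>f. LINT x|lebesgue_on {a..b}. (f x)\<^sup>2"
  have nn: "0 \<le> ?I f" "0 \<le> ?I g" by (auto intro: integral_nonneg_AE)
  have "?I (\<lambda>x. f x - g x) \<le> (LINT x|lebesgue_on {a..b}. 2 * (f x)\<^sup>2 + 2 * (g x)\<^sup>2)"
  proof (rule integral_mono)
    show "integrable (lebesgue_on {a..b}) (\<lambda>x. (f x - g x)\<^sup>2)"
      using L2_diff[OF assms] by (simp add: L2_def)
    show "(f x - g x)\<^sup>2 \<le> 2 * (f x)\<^sup>2 + 2 * (g x)\<^sup>2" for x
      using zero_le_power2[of "f x + g x"] by (simp add: power2_eq_square algebra_simps)
  qed (use assms in \<open>simp add: L2_def\<close>)
  also have "\<dots> = 2 * ?I f + 2 * ?I g" using assms by (simp add: L2_def)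
  also have "\<dots> \<le> (2 * sqrt (?I f) + 2 * sqrt (?I g))\<^sup>2"
    using nn by (simp add: power2_sum power_mult_distrib)
  finally show ?thesis
    using nn by (simp add: L2_norm_def real_le_lsqrt)
qed

text \<open>
  The Cauchy-Schwarz inequality. The squares of the two sides differ by \<open>b - a\<close> times the integral
  of \<open>(\<bar>f\<bar> - m)\<^sup>2\<close>, where \<open>m\<close> is the mean of \<open>\<bar>f\<bar>\<close>.
\<close>

lemma L1_le_L2_norm:
  assumes f: "f \<in> L2 {a..b}" and ab: "a < b"
  shows "(LINT x|lebesgue_on {a..b}. \<bar>f x\<bar>) \<le> sqrt (b - a) * L2_norm a b f"
proof -
  let ?J = "LINT x|lebesgue_on {a..b}. \<bar>f x\<bar>"
  define m where "m = ?J / (b - a)"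
  have f1: "integrable (lebesgue_on {a..b}) (\<lambda>x. \<bar>f x\<bar>)" using L2_integrable[OF f] by simp
  have f2: "integrable (lebesgue_on {a..b}) (\<lambda>x. (f x)\<^sup>2)" using f by (simp add: L2_def)
  have fc: "integrable (lebesgue_on {a..b}) (\<lambda>x. c)" for c :: real by (rule L2_integrable[OF L2_const])
  have "0 \<le> (LINT x|lebesgue_on {a..b}. (\<bar>f x\<bar> - m)\<^sup>2)" by (auto intro: integral_nonneg_AE)
  also have "\<dots> = (LINT x|lebesgue_on {a..b}. (f x)\<^sup>2 - (2 * m) * \<bar>f x\<bar> + m\<^sup>2)"
    by (rule Bochner_Integration.integral_cong) (auto simp: power2_diff)
  also have "\<dots> = (L2_norm a b f)\<^sup>2 - 2 * m * ?J + (b - a) * m\<^sup>2"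
    using f1 f2 fc ab by (simp add: L2_norm_def measure_restrict_space)
  also have "\<dots> = (L2_norm a b f)\<^sup>2 - ?J\<^sup>2 / (b - a)"
  proof -
    have J: "?J = m * (b - a)" using ab by (simp add: m_def)
    have *: "x - 2 * m * (m * d) + d * m\<^sup>2 = x - (m * d)\<^sup>2 / d" if "0 < d" for x d
      using that by (simp add: power2_eq_square)
    show ?thesis unfolding J by (rule *) (use ab in simp)
  qed
  finally have "?J\<^sup>2 \<le> (b - a) * (L2_norm a b f)\<^sup>2"
    using ab by (simp add: field_simps)
  also have "\<dots> = (sqrt (b - a) * L2_norm a b f)\<^sup>2"
    using ab by (simp add: power_mult_distrib)
  finally show ?thesis
    by (rule power2_le_imp_le) (use ab in simp)
qed


section \<open>Indefinite integrals of integrable functions\<close>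

definition primitive :: "real \<Rightarrow> (real \<Rightarrow> real) \<Rightarrow> real \<Rightarrow> real" where
  "primitive a v x = (LINT t|lebesgue_on {a..x}. v t)"

lemma primitive_eq_integral_if:
  assumes "x \<le> b"
  shows "primitive a v x = (LINT t|lebesgue_on {a..b}. (if t \<le> x then v t else 0))"
proof -
  have "primitive a v x = (LINT t|lebesgue_on {a..b}. (if t \<in> {a..x} then v t else 0))"
    unfolding primitive_def using assms by (intro integral_restrict[symmetric]) auto
  also have "\<dots> = (LINT t|lebesgue_on {a..b}. (if t \<le> x then v t else 0))"
    by (rule Bochner_Integration.integral_cong) auto
  finally show ?thesis .
qed

lemma integrable_sub:
  fixes v :: "real \<Rightarrow> real"
  shows "integrable (lebesgue_on {a..b}) v \<Longrightarrow> a \<le> c \<Longrightarrow> d \<le> b \<Longrightarrow> integrable (lebesgue_on {c..d}) v"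
  by (rule integrable_subinterval) auto

lemma continuous_primitive:
  "integrable (lebesgue_on {a..b}) v \<Longrightarrow> continuous_on {a..b} (primitive a v)"
  using indefinite_integral_continuous_real[of a b v] by (simp add: primitive_def[abs_def])

lemma primitive_at_start [simp]: "primitive a v a = 0"
proof -
  have "{a} \<in> null_sets lebesgue" by simp
  then show ?thesis unfolding primitive_def by (simp add: integral_eq_zero_null_sets)
qed

lemma primitive_cong:
  "(\<And>t. t \<in> {a..x} \<Longrightarrow> v t = w t) \<Longrightarrow> primitive a v x = primitive a w x"
  unfolding primitive_def by (rule Bochner_Integration.integral_cong) auto

lemma primitive_ae_eq:
  assumes "ae_eq a b v w" "x \<le> b"
  shows "primitive a v x = primitive a w x"
  using integral_ae_eq[OF ae_eq_lift[OF assms(1), of "\<lambda>t y. if t \<le> x then y else 0"]] assms(2)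
  by (simp add: primitive_eq_integral_if[of x b])

lemma primitive_lincomb:
  assumes "integrable (lebesgue_on {a..b}) v" "integrable (lebesgue_on {a..b}) w" "x \<in> {a..b}"
  shows "primitive a (\<lambda>t. c * v t + d * w t) x = c * primitive a v x + d * primitive a w x"
  using integrable_sub[OF assms(1), of a x] integrable_sub[OF assms(2), of a x] assms(3)
  by (simp add: primitive_def)

lemma primitive_FTC:
  assumes F: "\<And>t. t \<in> {a..b} \<Longrightarrow> (F has_real_derivative f t) (at t within {a..b})"
    and f: "continuous_on {a..b} f" and x: "x \<in> {a..b}"
  shows "primitive a f x = F x - F a"
proof -
  have c: "continuous_on {a..x} f" using f x by (auto intro: continuous_on_subset)
  have "(f has_integral (F x - F a)) {a..x}"
    using x by (intro fundamental_theorem_of_calculus)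
      (auto simp: has_real_derivative_iff_has_vector_derivative[symmetric] intro: DERIV_subset[OF F])
  moreover have "primitive a f x = integral {a..x} f"
    unfolding primitive_def using L2_integrable[OF L2_continuous[OF c]]
    by (intro lebesgue_integral_eq_integral) auto
  ultimately show ?thesis by (simp add: integral_unique)
qed

lemma integrable_mult_continuous:
  fixes f g :: "real \<Rightarrow> real"
  assumes f: "integrable (lebesgue_on {a..b}) f" and g: "continuous_on {a..b} g"
  shows "integrable (lebesgue_on {a..b}) (\<lambda>x. f x * g x)"
proof -
  obtain C where C: "\<And>x. x \<in> {a..b} \<Longrightarrow> norm (g x) \<le> C"
    using compact_imp_bounded[OF compact_continuous_image[OF g compact_Icc]] unfolding bounded_iff by blast
  have g': "g \<in> borel_measurable (lebesgue_on {a..b})"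
    using L2_continuous[OF g] by (simp add: L2_def)
  show ?thesis
  proof (rule Bochner_Integration.integrable_bound)
    show "integrable (lebesgue_on {a..b}) (\<lambda>x. C * f x)" using f by simp
    show "(\<lambda>x. f x * g x) \<in> borel_measurable (lebesgue_on {a..b})"
      using f g' by (auto intro!: borel_measurable_times)
    show "AE x in lebesgue_on {a..b}. norm (f x * g x) \<le> norm (C * f x)"
    proof (rule AE_I2)
      fix x assume "x \<in> space (lebesgue_on {a..b})"
      then have "\<bar>g x\<bar> \<le> \<bar>C\<bar>" using C[of x] by simp
      then show "norm (f x * g x) \<le> norm (C * f x)"
        using mult_left_mono[of "\<bar>g x\<bar>" "\<bar>C\<bar>" "\<bar>f x\<bar>"] by (simp add: abs_mult mult.commute)
    qed
  qed
qed

text \<open>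
  Integration by parts without any differentiability: the product of the two integrals is an
  integral over the square, and Fubini evaluates it over the two triangles on either side of the
  diagonal.
\<close>

lemma primitive_mult:
  assumes f: "integrable (lebesgue_on {a..b}) f" and g: "integrable (lebesgue_on {a..b}) g"
  shows "(LINT x|lebesgue_on {a..b}. f x * primitive a g x + g x * primitive a f x)
         = primitive a f b * primitive a g b"
proof -
  let ?M = "lebesgue_on {a..b}"
  interpret M: finite_measure ?M by (intro finite_measure_lebesgue_on) simp
  interpret P: pair_sigma_finite ?M ?M ..
  have [measurable]: "f \<in> borel_measurable ?M" "g \<in> borel_measurable ?M"
    using f g by auto
  have [measurable]: "(\<lambda>x. x) \<in> borel_measurable ?M"
    using id_borel_measurable_lebesgue_on[of "{a..b}"] by (simp add: id_def)
  have h: "integrable (?M \<Otimes>\<^sub>M ?M) (\<lambda>(x, y). f x * g y)"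
  proof (rule P.Fubini_integrable)
    show "(\<lambda>(x, y). f x * g y) \<in> borel_measurable (?M \<Otimes>\<^sub>M ?M)" by measurable
    show "integrable ?M (\<lambda>x. LINT y|?M. norm (case (x, y) of (x, y) \<Rightarrow> f x * g y))"
      using f by (simp add: abs_mult)
    show "AE x in ?M. integrable ?M (\<lambda>y. case (x, y) of (x, y) \<Rightarrow> f x * g y)"
      using g by simp
  qed
  (* the two triangles of the square, below and above the diagonal *)
  define h1 where "h1 = (\<lambda>x y. if y \<le> x then f x * g y else 0)"
  define h2 where "h2 = (\<lambda>x y. if x < y then f x * g y else 0)"
  have h1: "integrable (?M \<Otimes>\<^sub>M ?M) (case_prod h1)"
  proof (rule Bochner_Integration.integrable_bound[OF h])
    show "case_prod h1 \<in> borel_measurable (?M \<Otimes>\<^sub>M ?M)" unfolding h1_def by measurable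
  qed (auto simp: h1_def)
  have h2: "integrable (?M \<Otimes>\<^sub>M ?M) (case_prod h2)"
  proof (rule Bochner_Integration.integrable_bound[OF h])
    show "case_prod h2 \<in> borel_measurable (?M \<Otimes>\<^sub>M ?M)" unfolding h2_def by measurable
  qed (auto simp: h2_def)
  have I1: "(LINT y|?M. h1 x y) = f x * primitive a g x" if "x \<in> {a..b}" for x
  proof -
    have "(LINT y|?M. h1 x y) = (LINT y|?M. f x * (if y \<le> x then g y else 0))"
      by (rule Bochner_Integration.integral_cong) (auto simp: h1_def)
    then show ?thesis using that by (simp add: primitive_eq_integral_if[of x b])
  qed
  have I2: "(LINT x|?M. h2 x y) = g y * primitive a f y" if "y \<in> {a..b}" for y
  proof -
    (* h2 omits the diagonal, a null set in each line *)
    have "AE x in ?M. x \<noteq> y"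
      using AE_lborel_singleton[of y] by (auto simp: AE_restrict_space_iff AE_completion_iff elim: eventually_mono)
    then have "(LINT x|?M. h2 x y) = (LINT x|?M. g y * (if x \<le> y then f x else 0))"
      unfolding h2_def by (intro integral_ae_eq) (unfold ae_eq_def, erule eventually_mono, auto)
    then show ?thesis using that by (simp add: primitive_eq_integral_if[of y b])
  qed
  have "primitive a f b * primitive a g b = (LINT x|?M. LINT y|?M. f x * g y)"
    by (simp add: primitive_def)
  also have "\<dots> = (LINT x|?M. LINT y|?M. h1 x y + h2 x y)"
    by (intro Bochner_Integration.integral_cong) (auto simp: h1_def h2_def)
  also have "\<dots> = (LINT p|(?M \<Otimes>\<^sub>M ?M). case_prod h1 p + case_prod h2 p)"
    using P.integral_fst[of "\<lambda>x y. h1 x y + h2 x y"] Bochner_Integration.integrable_add[OF h1 h2]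
    by (simp add: case_prod_beta')
  also have "\<dots> = (LINT x|?M. LINT y|?M. h1 x y) + (LINT y|?M. LINT x|?M. h2 x y)"
    using P.integral_fst[OF h1] P.integral_snd[OF h2] h1 h2 by simp
  also have "(LINT x|?M. LINT y|?M. h1 x y) = (LINT x|?M. f x * primitive a g x)"
    by (rule Bochner_Integration.integral_cong) (auto simp: I1)
  also have "(LINT y|?M. LINT x|?M. h2 x y) = (LINT x|?M. g x * primitive a f x)"
    by (rule Bochner_Integration.integral_cong) (auto simp: I2)
  also have "(LINT x|?M. f x * primitive a g x) + (LINT x|?M. g x * primitive a f x) =
      (LINT x|?M. f x * primitive a g x + g x * primitive a f x)"
    using integrable_mult_continuous[OF f continuous_primitive[OF g]]
      integrable_mult_continuous[OF g continuous_primitive[OF f]] by simp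
  finally show ?thesis by simp
qed

text \<open>
  The sets over which \<open>v\<close> integrates to 0 form a Dynkin system; it contains the half-lines, hence
  all Borel sets.
\<close>

lemma primitive_eq_0_imp_ae_0:
  assumes v: "integrable (lebesgue_on {a..b}) v"
    and 0: "\<And>x. x \<in> {a..b} \<Longrightarrow> primitive a v x = 0"
  shows "ae_eq a b v (\<lambda>_. 0)"
proof -
  (* half-lines generate only the Borel sets, so v is replaced by a Borel representative f' *)
  define f where "f = (\<lambda>x. if x \<in> {a..b} then v x else 0)"
  have f: "integrable lebesgue f"
    unfolding f_def using v by (subst Lebesgue_Measure.integrable_restrict_UNIV) auto
  then obtain f' where [measurable]: "f' \<in> borel_measurable lborel" and ff': "AE x in lborel. f x = f' x"
    using completion_ex_borel_measurable_real[OF borel_measurable_integrable[OF f]] by auto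
  have ff'': "AE x in lebesgue. f x = f' x" using ff' by (rule AE_completion)
  have [measurable]: "f \<in> borel_measurable lebesgue" "f' \<in> borel_measurable lebesgue"
    using f by (auto intro: measurable_completion)
  have f': "integrable lborel f'"
    using integrable_cong_AE[of f lebesgue f'] ff'' f integrable_completion[of f' lborel] by simp
  have half: "set_lebesgue_integral lborel {..x} f' = 0" for x
  proof -
    have "set_lebesgue_integral lborel {..x} f' = (LINT t|lebesgue. indicator {..x} t * f' t)"
      by (simp add: set_lebesgue_integral_def integral_completion)
    also have "\<dots> = (LINT t|lebesgue. (if t \<in> {a..min x b} then v t else 0))"
    proof (rule integral_cong_AE)
      show "(\<lambda>t. if t \<in> {a..min x b} then v t else 0) \<in> borel_measurable lebesgue"
        using integrable_sub[OF v, of a "min x b"] by (intro borel_measurable_if_I) auto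
      show "AE t in lebesgue. indicator {..x} t * f' t = (if t \<in> {a..min x b} then v t else 0)"
        using ff'' by eventually_elim (auto simp: f_def indicator_def)
      show "(\<lambda>t. indicator {..x} t * f' t) \<in> borel_measurable lebesgue"
        by (intro borel_measurable_times borel_measurable_indicator) auto
    qed
    also have "\<dots> = primitive a v (min x b)"
      unfolding primitive_def by (rule Lebesgue_Measure.integral_restrict_UNIV) auto
    also have "\<dots> = 0"
      using 0[of "min x b"] by (cases "a \<le> min x b") (auto simp: primitive_def)
    finally show ?thesis .
  qed
  have total: "integral\<^sup>L lborel f' = 0"
  proof -
    have "integral\<^sup>L lborel f' = set_lebesgue_integral lborel {..b} f'"
      unfolding set_lebesgue_integral_def using ff'
      by (intro integral_cong_AE) (auto simp: f_def indicator_def elim!: eventually_mono)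
    with half show ?thesis by simp
  qed
  have sets: "set_integrable lborel A f'" if "A \<in> sets borel" for A
    using that integrable_mult_indicator[OF _ f', of A] by (simp add: set_integrable_def)
  have "set_lebesgue_integral lborel A f' = 0" if A: "A \<in> sets lborel" for A
  proof -
    have borel: "sigma_sets UNIV (range atMost) = sets (borel :: real measure)"
      by (simp add: borel_eq_atMost)
    have "Int_stable (range (atMost :: real \<Rightarrow> real set))"
      by (auto simp: Int_stable_def)
    moreover have "range (atMost :: real \<Rightarrow> real set) \<subseteq> Pow UNIV" by simp
    moreover have "A \<in> sigma_sets UNIV (range atMost)"
      using A by (simp add: borel)
    ultimately show ?thesis
    proof (induction rule: sigma_sets_induct_disjoint)
      case (basic A)
      then show ?case using half by auto
    next
      case empty
      then show ?case by (simp add: set_lebesgue_integral_def)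
    next
      case (compl A)
      then have "A \<in> sets borel" by (simp add: borel)
      have "set_lebesgue_integral lborel (UNIV - A) f'
          = (LINT t|lborel. f' t - indicator A t * f' t)"
        unfolding set_lebesgue_integral_def
        by (rule Bochner_Integration.integral_cong) (auto simp: indicator_def)
      also have "\<dots> = integral\<^sup>L lborel f' - set_lebesgue_integral lborel A f'"
        using f' sets[OF \<open>A \<in> sets borel\<close>]
        by (simp add: set_lebesgue_integral_def set_integrable_def)
      finally show ?case using total compl by simp
    next
      case (union A)
      then have *: "A i \<in> sets borel" for i by (auto simp: borel)
      have "(LINT x:(\<Union>i. A i)|lborel. f' x) = (\<Sum>i. (LINT x:(A i)|lborel. f' x))"
        using * union by (intro lebesgue_integral_countable_add sets) (auto simp: disjoint_family_on_def)
      with union show ?case by simp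
    qed
  qed
  then have "AE x in lborel. f' x = (\<lambda>_. 0) x"
    using f' by (intro density_unique_real) (auto simp: set_lebesgue_integral_def)
  then have "AE x in lebesgue. f' x = 0" by (auto intro: AE_completion)
  with ff'' have "AE x in lebesgue. x \<in> {a..b} \<longrightarrow> v x = 0"
    by eventually_elim (auto simp: f_def split: if_splits)
  then show ?thesis by (simp add: ae_eq_def AE_restrict_space_iff)
qed


section \<open>Weak derivatives\<close>

lemma test_function_facts:
  assumes "test_function a b \<phi> \<phi>'"
  shows "continuous_on {a..b} \<phi>" "continuous_on {a..b} \<phi>'" "\<phi> a = 0" "\<phi> b = 0"
    and "x \<in> {a..b} \<Longrightarrow> primitive a \<phi>' x = \<phi> x"
proof -
  have d: "(\<phi> has_real_derivative \<phi>' x) (at x)" for x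
    using assms by (simp add: test_function_def)
  obtain c d where *: "a < c" "c \<le> d" "d < b" "\<And>x. x \<notin> {c..d} \<Longrightarrow> \<phi> x = 0"
    using assms unfolding test_function_def by blast
  show "continuous_on {a..b} \<phi>"
    using d by (intro continuous_at_imp_continuous_on) (auto intro: DERIV_isCont)
  show c': "continuous_on {a..b} \<phi>'"
    using assms by (auto simp: test_function_def intro: continuous_on_subset)
  show 0: "\<phi> a = 0" "\<phi> b = 0" using * by auto
  show "primitive a \<phi>' x = \<phi> x" if "x \<in> {a..b}"
    using primitive_FTC[OF DERIV_subset[OF d] c' that] 0 by simp
qed

text \<open>
  A test function is itself the primitive of its derivative and vanishes at both ends, so this is
  integration by parts in the form of \<open>primitive_mult\<close>.
\<close>

lemma is_weak_deriv_primitive: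
  assumes v: "integrable (lebesgue_on {a..b}) v"
  shows "is_weak_deriv a b (\<lambda>x. c + primitive a v x) v"
  unfolding is_weak_deriv_def
proof (intro allI impI)
  fix \<phi> \<phi>' assume t: "test_function a b \<phi> \<phi>'"
  let ?M = "lebesgue_on {a..b}"
  note t' = test_function_facts[OF t]
  have ip: "integrable ?M \<phi>'" by (rule L2_integrable[OF L2_continuous[OF t'(2)]]) simp
  have i1: "integrable ?M (\<lambda>x. \<phi>' x * primitive a v x)"
    by (rule integrable_mult_continuous[OF ip continuous_primitive[OF v]])
  have i2: "integrable ?M (\<lambda>x. v x * \<phi> x)"
    by (rule integrable_mult_continuous[OF v t'(1)])
  have ab: "a \<le> b" using t unfolding test_function_def by fastforce
  have int0: "(LINT x|?M. \<phi>' x) = 0"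
    using t'(5)[where x = b] t'(4) ab by (simp add: primitive_def)
  have "(LINT x|?M. v x * \<phi> x) + (LINT x|?M. \<phi>' x * primitive a v x)
      = (LINT x|?M. v x * \<phi> x + \<phi>' x * primitive a v x)"
    using i1 i2 by simp
  also have "\<dots> = (LINT x|?M. v x * primitive a \<phi>' x + \<phi>' x * primitive a v x)"
    by (rule Bochner_Integration.integral_cong) (auto simp: t'(5))
  also have "\<dots> = 0"
    unfolding primitive_mult[OF v ip] using t'(4) t'(5)[where x = b] ab by simp
  finally have "(LINT x|?M. \<phi>' x * primitive a v x) = - (LINT x|?M. v x * \<phi> x)" by simp
  moreover have "(LINT x|?M. (c + primitive a v x) * \<phi>' x)
      = (LINT x|?M. c * \<phi>' x + \<phi>' x * primitive a v x)"
    by (simp add: algebra_simps)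
  moreover have "\<dots> = c * (LINT x|?M. \<phi>' x) + (LINT x|?M. \<phi>' x * primitive a v x)"
    using ip i1 by simp
  ultimately show "(LINT x|?M. (c + primitive a v x) * \<phi>' x) = - (LINT x|?M. v x * \<phi> x)"
    using int0 by simp
qed

lemma is_weak_deriv_ae_eq:
  assumes "ae_eq a b u u'" "ae_eq a b g g'"
  shows "is_weak_deriv a b u g \<longleftrightarrow> is_weak_deriv a b u' g'"
proof -
  have "(LINT x|lebesgue_on {a..b}. u x * \<phi> x) = (LINT x|lebesgue_on {a..b}. u' x * \<phi> x)"
    "(LINT x|lebesgue_on {a..b}. g x * \<phi> x) = (LINT x|lebesgue_on {a..b}. g' x * \<phi> x)" for \<phi>
    using integral_ae_eq[OF ae_eq_lift[OF assms(1), of "\<lambda>x y. y * \<phi> x"]]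
      integral_ae_eq[OF ae_eq_lift[OF assms(2), of "\<lambda>x y. y * \<phi> x"]] by auto
  then show ?thesis by (simp add: is_weak_deriv_def)
qed

lemma is_weak_deriv_lincomb:
  assumes i: "integrable (lebesgue_on {a..b}) u" "integrable (lebesgue_on {a..b}) g"
    "integrable (lebesgue_on {a..b}) u'" "integrable (lebesgue_on {a..b}) g'"
    and w: "is_weak_deriv a b u g" "is_weak_deriv a b u' g'"
  shows "is_weak_deriv a b (\<lambda>x. c * u x + d * u' x) (\<lambda>x. c * g x + d * g' x)"
  unfolding is_weak_deriv_def
proof (intro allI impI)
  fix \<phi> \<phi>' assume t: "test_function a b \<phi> \<phi>'"
  note t' = test_function_facts[OF t]
  let ?M = "lebesgue_on {a..b}"
  have *: "(LINT x|?M. (c * p x + d * q x) * h x) = c * (LINT x|?M. p x * h x) + d * (LINT x|?M. q x * h x)"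
    if "integrable ?M p" "integrable ?M q" "continuous_on {a..b} h" for p q h
  proof -
    have "(LINT x|?M. (c * p x + d * q x) * h x) = (LINT x|?M. c * (p x * h x) + d * (q x * h x))"
      by (simp add: algebra_simps)
    also have "\<dots> = c * (LINT x|?M. p x * h x) + d * (LINT x|?M. q x * h x)"
      using integrable_mult_continuous[OF that(1,3)] integrable_mult_continuous[OF that(2,3)] by simp
    finally show ?thesis .
  qed
  show "(LINT x|?M. (c * u x + d * u' x) * \<phi>' x) = - (LINT x|?M. (c * g x + d * g' x) * \<phi> x)"
    using *[OF i(1,3) t'(2)] *[OF i(2,4) t'(1)] w t by (simp add: is_weak_deriv_def)
qed

text \<open>
  An antiderivative of \<open>\<psi>\<close> is constant to the left of \<open>c\<close> and to the right of \<open>d\<close>; the vanishing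
  mean makes the two constants equal, so subtracting them leaves compact support.
\<close>

lemma ex_test_function:
  assumes \<psi>: "continuous_on UNIV \<psi>" and supp: "a < c" "c \<le> d" "d < b" "\<And>x. x \<notin> {c<..<d} \<Longrightarrow> \<psi> x = 0"
    and int: "(LINT x|lebesgue_on {a..b}. \<psi> x) = 0"
  shows "\<exists>\<phi>. test_function a b \<phi> \<psi>"
proof -
  have "\<exists>F. \<forall>x::real. -\<infinity> < ereal x \<longrightarrow> ereal x < \<infinity> \<longrightarrow> (F has_vector_derivative \<psi> x) (at x)"
    using \<psi> by (intro einterval_antiderivative) (auto simp: continuous_on_eq_continuous_at)
  then obtain F where F: "\<And>x. (F has_real_derivative \<psi> x) (at x)"
    by (auto simp: has_real_derivative_iff_has_vector_derivative)
  have cont: "continuous_on {x..y} \<psi>" for x y using \<psi> by (rule continuous_on_subset) simp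
  have const: "F x = F y" if "x \<le> y" "\<And>t. t \<in> {x..y} \<Longrightarrow> \<psi> t = 0" for x y
    using primitive_FTC[OF DERIV_subset[OF F] cont, where a = x and b = y and x = y] that primitive_cong[of x y \<psi> "\<lambda>_. 0"]
    by (simp add: primitive_def)
  have Fab: "F b = F a"
    using primitive_FTC[OF DERIV_subset[OF F] cont, where a = a and b = b and x = b] int supp by (simp add: primitive_def)
  have "F x - F a = 0" if x: "x \<notin> {c..d}" for x
  proof (cases "x < c")
    case True
    then have "F (min x a) = F (max x a)"
      using supp(1) by (intro const supp(4)) (auto simp: min_def max_def split: if_splits)
    then show ?thesis by (auto simp: min_def max_def split: if_splits)
  next
    case False
    then have "F (min x b) = F (max x b)"
      using supp(3) x by (intro const supp(4)) (auto simp: min_def max_def split: if_splits)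
    then show ?thesis using Fab by (auto simp: min_def max_def split: if_splits)
  qed
  moreover have "((\<lambda>x. F x - F a) has_real_derivative \<psi> x) (at x)" for x
    using F[of x] by (auto intro!: derivative_eq_intros)
  ultimately have "test_function a b (\<lambda>x. F x - F a) \<psi>"
    unfolding test_function_def using \<psi> supp by blast
  then show ?thesis by blast
qed

text \<open>
  Continuous functions supported in \<open>[c, d]\<close> that increase to the indicator function of the open
  interval as \<open>n\<close> grows.
\<close>

definition trapezoid :: "real \<Rightarrow> real \<Rightarrow> nat \<Rightarrow> real \<Rightarrow> real" where
  "trapezoid c d n x = min 1 (real n * max 0 (min (x - c) (d - x)))"

lemma trapezoid_props:
  "continuous_on UNIV (trapezoid c d n)" "x \<notin> {c<..<d} \<Longrightarrow> trapezoid c d n x = 0"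
  "\<bar>trapezoid c d n x\<bar> \<le> 1"
  by (auto simp: trapezoid_def[abs_def] intro!: continuous_intros)

lemma trapezoid_tendsto: "(\<lambda>n. trapezoid c d n x) \<longlonglongrightarrow> indicator {c<..<d} x"
proof (cases "x \<in> {c<..<d}")
  case True
  define m where "m = min (x - c) (d - x)"
  have m: "0 < m" using True by (simp add: m_def)
  obtain n0 where n0: "1 < real n0 * m" using reals_Archimedean3[OF m] by blast
  have "trapezoid c d n x = 1" if "n \<ge> n0" for n
  proof -
    have "real n0 * m \<le> real n * m" using that m by (intro mult_right_mono) auto
    moreover have "max 0 m = m" using m by simp
    ultimately have "1 \<le> real n * max 0 m" using n0 by linarith
    then show ?thesis unfolding trapezoid_def m_def[symmetric] by (rule min_absorb1)
  qed
  then have "\<forall>\<^sub>F n in sequentially. trapezoid c d n x = 1"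
    unfolding eventually_sequentially by blast
  then show ?thesis using True by (simp add: tendsto_eventually)
next
  case False
  then show ?thesis using trapezoid_props(2)[OF False] by simp
qed

lemma trapezoid_integral_tendsto:
  assumes u: "integrable (lebesgue_on {a..b}) u" and "a \<le> c" "c \<le> d" "d \<le> b"
  shows "(\<lambda>n. LINT x|lebesgue_on {a..b}. u x * trapezoid c d n x) \<longlonglongrightarrow> primitive a u d - primitive a u c"
proof -
  let ?M = "lebesgue_on {a..b}"
  have tm: "trapezoid c d n \<in> borel_measurable ?M" for n
    using L2_continuous[OF continuous_on_subset[OF trapezoid_props(1)], of "{a..b}"]
    by (simp add: L2_def)
  have "(\<lambda>n. LINT x|?M. u x * trapezoid c d n x) \<longlonglongrightarrow> (LINT x|?M. u x * indicator {c<..<d} x)"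
  proof (rule integral_dominated_convergence[where w = "\<lambda>x. \<bar>u x\<bar>"])
    show "(\<lambda>x. u x * indicator {c<..<d} x) \<in> borel_measurable ?M"
      using u assms by (intro borel_measurable_times borel_measurable_indicator)
        (auto simp: sets_restrict_space_iff)
    show "(\<lambda>x. u x * trapezoid c d n x) \<in> borel_measurable ?M" for n
      using u tm by (intro borel_measurable_times) auto
    show "AE x in ?M. (\<lambda>n. u x * trapezoid c d n x) \<longlonglongrightarrow> u x * indicator {c<..<d} x"
      by (intro AE_I2 tendsto_mult tendsto_const trapezoid_tendsto)
    show "AE x in ?M. norm (u x * trapezoid c d n x) \<le> \<bar>u x\<bar>" for n
      using mult_left_le[OF trapezoid_props(3)] by (intro AE_I2) (simp add: abs_mult)
  qed (use u in simp)
  also have "(LINT x|?M. u x * indicator {c<..<d} x)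
      = (LINT x|?M. (if x \<le> d then u x else 0) - (if x \<le> c then u x else 0))"
  proof (rule integral_ae_eq)
    have "AE x in ?M. x \<noteq> d"
      using AE_lborel_singleton[of d] by (auto simp: AE_restrict_space_iff AE_completion_iff elim: eventually_mono)
    then show "ae_eq a b (\<lambda>x. u x * indicator {c<..<d} x)
        (\<lambda>x. (if x \<le> d then u x else 0) - (if x \<le> c then u x else 0))"
      unfolding ae_eq_def by (rule eventually_mono) (use assms in \<open>auto simp: indicator_def\<close>)
  qed
  also have "\<dots> = primitive a u d - primitive a u c"
  proof -
    have *: "integrable ?M (\<lambda>x. if x \<le> e then u x else 0)" for e
    proof (rule Bochner_Integration.integrable_bound[OF u])
      have "{x. x \<le> e} \<inter> {a..b} \<in> sets ?M"
        by (auto simp: sets_restrict_space_iff)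
      then show "(\<lambda>x. if x \<le> e then u x else 0) \<in> borel_measurable ?M"
        using u by (intro measurable_If) (auto simp: Int_commute Int_def)
    qed auto
    show ?thesis using assms * by (simp add: primitive_eq_integral_if[of _ b])
  qed
  finally show ?thesis .
qed

text \<open>
  The lemma of du Bois-Reymond. Subtracting from a continuous \<open>\<psi>\<close> of compact support a suitable
  multiple of a fixed \<open>\<psi>\<^sub>0\<close> gives it mean 0 and so makes it the derivative of a test function. Hence
  \<open>u\<close> and some constant \<open>k\<close> have equal integrals against every such \<open>\<psi>\<close>. When \<open>\<psi>\<close> approaches the
  indicator function of a subinterval, this says that \<open>u\<close> and \<open>k\<close> have equal integrals over it.
\<close>

lemma weak_deriv_0_imp_const:
  assumes u: "integrable (lebesgue_on {a..b}) u" and w: "is_weak_deriv a b u (\<lambda>_. 0)" and ab: "a < b"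
  shows "\<exists>k. ae_eq a b u (\<lambda>_. k)"
proof -
  let ?M = "lebesgue_on {a..b}"
  let ?J = "\<lambda>u c d n. LINT x|?M. u x * trapezoid c d n x"
  have one: "integrable ?M (\<lambda>_. k)" for k :: real by (rule L2_integrable[OF L2_const])
  have prim_const: "primitive a (\<lambda>_. 1) x = x - a" if "x \<in> {a..b}" for x
    using primitive_FTC[of a b "\<lambda>x. x" "\<lambda>_. 1" x] that by simp
  (* any interval with closure inside the open interval would do *)
  define c0 d0 where "c0 = a + (b - a) / 3" and "d0 = a + 2 * (b - a) / 3"
  have cd0: "a < c0" "c0 < d0" "d0 < b" using ab by (auto simp: c0_def d0_def field_simps)
  have "(\<lambda>n. ?J (\<lambda>_. 1) c0 d0 n) \<longlonglongrightarrow> d0 - c0"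
    using trapezoid_integral_tendsto[OF one, of c0 d0 1] prim_const[of c0] prim_const[of d0] cd0 by simp
  then have "\<forall>\<^sub>F n in sequentially. 0 < ?J (\<lambda>_. 1) c0 d0 n"
    using cd0 by (intro order_tendstoD(1)) auto
  then obtain n0 where n0: "0 < ?J (\<lambda>_. 1) c0 d0 n0"
    by (meson eventually_happens sequentially_bot)
  (* trapezoid c0 d0 n0 is the fixed function with nonzero mean I0 *)
  define I0 where "I0 = ?J (\<lambda>_. 1) c0 d0 n0"
  define k where "k = ?J u c0 d0 n0 / I0"
  have I0: "I0 > 0" using n0 by (simp add: I0_def)
  have cont: "continuous_on {a..b} (trapezoid c d n)" for c d n
    using trapezoid_props(1) by (rule continuous_on_subset) simp
  have J: "?J u c d n = k * ?J (\<lambda>_. 1) c d n" if cd: "a < c" "c < d" "d < b" for c d n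
  proof -
    define r where "r = ?J (\<lambda>_. 1) c d n / I0"
    let ?\<psi> = "\<lambda>x. trapezoid c d n x - r * trapezoid c0 d0 n0 x"
    have int: "(LINT x|?M. v x * ?\<psi> x) = ?J v c d n - r * ?J v c0 d0 n0"
      if v: "integrable ?M v" for v
    proof -
      have "(LINT x|?M. v x * ?\<psi> x) = (LINT x|?M. v x * trapezoid c d n x - r * (v x * trapezoid c0 d0 n0 x))"
        by (simp add: algebra_simps)
      then show ?thesis
        using integrable_mult_continuous[OF v cont[of c d n]]
          integrable_mult_continuous[OF v cont[of c0 d0 n0]] by simp
    qed
    have "\<exists>\<phi>. test_function a b \<phi> ?\<psi>"
    proof (rule ex_test_function)
      show "continuous_on UNIV ?\<psi>" by (intro continuous_intros trapezoid_props)
      show "a < min c c0" "min c c0 \<le> max d d0" "max d d0 < b" using cd cd0 by auto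
      show "?\<psi> x = 0" if "x \<notin> {min c c0<..<max d d0}" for x
      proof -
        have "x \<notin> {c<..<d}" "x \<notin> {c0<..<d0}" using that by (auto simp: min_def max_def split: if_splits)
        then show ?thesis by (simp add: trapezoid_props(2))
      qed
      show "(LINT x|?M. ?\<psi> x) = 0"
        using int[OF one[of 1]] I0 by (simp add: r_def I0_def)
    qed
    then have "(LINT x|?M. u x * ?\<psi> x) = 0" using w by (auto simp: is_weak_deriv_def)
    then show ?thesis using int[OF u] I0 by (simp add: r_def k_def field_simps)
  qed
  have inner: "primitive a u d - primitive a u c = k * (d - c)" if cd: "a < c" "c < d" "d < b" for c d
  proof -
    have "(\<lambda>n. ?J u c d n) \<longlonglongrightarrow> primitive a u d - primitive a u c"
      using cd by (intro trapezoid_integral_tendsto[OF u]) auto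
    moreover have "(\<lambda>n. k * ?J (\<lambda>_. 1) c d n) \<longlonglongrightarrow> k * (d - c)"
      using trapezoid_integral_tendsto[OF one, of c d 1] prim_const[of c] prim_const[of d] cd
      by (intro tendsto_mult tendsto_const) simp
    ultimately show ?thesis using J[OF cd] LIMSEQ_unique by simp
  qed
  (* h vanishes on the whole interval because it is constant inside and 0 at the left end *)
  define h where "h x = primitive a u x - k * (x - a)" for x
  have h: "continuous_on {a..b} h"
    unfolding h_def by (intro continuous_intros continuous_primitive u)
  have "h x = h c0" if "x \<in> {a<..<b}" for x
    using inner[of x c0] inner[of c0 x] that cd0
    by (cases x c0 rule: linorder_cases) (auto simp: h_def algebra_simps)
  moreover have "closure {a<..<b} = {a..b}" using ab by simp
  ultimately have hc: "h x = h c0" if "x \<in> {a..b}" for x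
    using continuous_constant_on_closure[of "{a<..<b}" h "h c0" x] h that by simp
  have h0: "h x = 0" if "x \<in> {a..b}" for x
    using hc[OF that] hc[of a] ab by (simp add: h_def)
  have "ae_eq a b (\<lambda>x. 1 * u x + (- k) * 1) (\<lambda>_. 0)"
  proof (rule primitive_eq_0_imp_ae_0)
    show "integrable ?M (\<lambda>x. 1 * u x + (- k) * 1)" using u one by simp
    show "primitive a (\<lambda>x. 1 * u x + (- k) * 1) x = 0" if "x \<in> {a..b}" for x
      using primitive_lincomb[OF u one that, of 1 "-k" 1] h0[OF that] prim_const[OF that]
      by (simp add: h_def)
  qed
  from ae_eq_lift[OF this, of "\<lambda>_ y. y + k"] have "ae_eq a b u (\<lambda>_. k)" by simp
  then show ?thesis by blast
qed

lemma continuous_ae_eq_imp_eq: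
  assumes "continuous_on {a..b} f" "continuous_on {a..b} g" "ae_eq a b f g" "a < b" "x \<in> {a..b}"
  shows "f x = g x"
proof -
  define C where "C = {x \<in> {a..b}. f x - g x = 0}"
  have "closed C"
    unfolding C_def using assms by (intro continuous_closed_preimage_constant continuous_intros) auto
  have "AE x\<in>{a<..<b} in lebesgue. x \<in> C"
    using assms(3) by (auto simp: ae_eq_def AE_restrict_space_iff C_def elim: eventually_mono)
  then have "{a<..<b} \<subseteq> C"
    by (intro subsetI) (rule mem_closed_if_AE_lebesgue_open[OF open_greaterThanLessThan \<open>closed C\<close>])
  then have "closure {a<..<b} \<subseteq> C" using \<open>closed C\<close> by (rule closure_minimal)
  then show ?thesis using assms(4,5) by (auto simp: C_def)
qed

text \<open>
  Integrating by parts reduces this to the previous lemma: the indefinite integral of \<open>g\<close> has weak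
  derivative 0 if \<open>g\<close> is a weak derivative of 0.
\<close>

lemma weak_deriv_of_0:
  assumes g: "integrable (lebesgue_on {a..b}) g" and w: "is_weak_deriv a b (\<lambda>_. 0) g" and ab: "a < b"
  shows "ae_eq a b g (\<lambda>_. 0)"
proof (rule primitive_eq_0_imp_ae_0[OF g])
  let ?G = "\<lambda>x. 0 + primitive a g x"
  have cont: "continuous_on {a..b} ?G" using continuous_primitive[OF g] by simp
  have "is_weak_deriv a b ?G (\<lambda>_. 0)"
    using is_weak_deriv_primitive[OF g, of 0] w by (simp add: is_weak_deriv_def)
  then obtain k where "ae_eq a b ?G (\<lambda>_. k)"
    using weak_deriv_0_imp_const[OF L2_integrable[OF L2_continuous[OF cont]]] ab by auto
  then have k: "primitive a g x = k" if "x \<in> {a..b}" for x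
    using continuous_ae_eq_imp_eq[OF cont continuous_on_const _ ab that] by simp
  show "primitive a g x = 0" if "x \<in> {a..b}" for x
    using k[OF that] k[of a] ab by simp
qed


lemma weak_deriv_unique:
  assumes g: "integrable (lebesgue_on {a..b}) g" and g': "integrable (lebesgue_on {a..b}) g'"
    and w: "is_weak_deriv a b u g" "is_weak_deriv a b u g'" and ab: "a < b"
  shows "ae_eq a b g g'"
proof -
  let ?h = "\<lambda>x. 1 * g x + (-1) * g' x"
  have "is_weak_deriv a b (\<lambda>_. 0) ?h"
    unfolding is_weak_deriv_def
  proof (intro allI impI)
    fix \<phi> \<phi>' assume t: "test_function a b \<phi> \<phi>'"
    note c = test_function_facts(1)[OF t]
    have "(LINT x|lebesgue_on {a..b}. ?h x * \<phi> x) = (LINT x|lebesgue_on {a..b}. g x * \<phi> x - g' x * \<phi> x)"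
      by (rule Bochner_Integration.integral_cong) (simp_all add: left_diff_distrib)
    also have "\<dots> = (LINT x|lebesgue_on {a..b}. g x * \<phi> x) - (LINT x|lebesgue_on {a..b}. g' x * \<phi> x)"
      using integrable_mult_continuous[OF g c] integrable_mult_continuous[OF g' c]
      by (rule Bochner_Integration.integral_diff)
    also have "\<dots> = 0"
      using w[unfolded is_weak_deriv_def, rule_format, OF t] by linarith
    finally show "(LINT x|lebesgue_on {a..b}. 0 * \<phi>' x) = - (LINT x|lebesgue_on {a..b}. ?h x * \<phi> x)"
      by simp
  qed
  then have "ae_eq a b ?h (\<lambda>_. 0)" using g g' by (intro weak_deriv_of_0 ab) auto
  from ae_eq_lift2[OF this ae_eq_refl[of a b g'], of "\<lambda>_ y z. y + z"] show ?thesis by simp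
qed

text \<open>
  The difference of the two sides has weak derivative 0.
\<close>

lemma weak_deriv_imp_primitive:
  assumes u: "integrable (lebesgue_on {a..b}) u" and g: "integrable (lebesgue_on {a..b}) g"
    and w: "is_weak_deriv a b u g" and ab: "a < b"
  shows "\<exists>c. ae_eq a b u (\<lambda>x. c + primitive a g x)"
proof -
  let ?G = "\<lambda>x. 0 + primitive a g x"
  have G: "integrable (lebesgue_on {a..b}) ?G"
    using L2_integrable[OF L2_continuous[OF continuous_primitive[OF g]]] by simp
  have "is_weak_deriv a b (\<lambda>x. 1 * u x + (-1) * ?G x) (\<lambda>x. 1 * g x + (-1) * g x)"
    by (rule is_weak_deriv_lincomb[OF u g G g w is_weak_deriv_primitive[OF g]])
  then have "is_weak_deriv a b (\<lambda>x. 1 * u x + (-1) * ?G x) (\<lambda>_. 0)" by simp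
  then obtain c where "ae_eq a b (\<lambda>x. 1 * u x + (-1) * ?G x) (\<lambda>_. c)"
    using weak_deriv_0_imp_const[OF _ _ ab] u G by fastforce
  from ae_eq_lift[OF this, of "\<lambda>x y. y + primitive a g x"]
  have "ae_eq a b u (\<lambda>x. c + primitive a g x)" by simp
  then show ?thesis by blast
qed

lemma weak_deriv_eqI:
  assumes g: "g \<in> L2 {a..b}" and w: "is_weak_deriv a b u g" and ab: "a < b"
  shows "weak_deriv a b u \<in> L2 {a..b}" "is_weak_deriv a b u (weak_deriv a b u)"
    and "ae_eq a b (weak_deriv a b u) g"
proof -
  have "weak_deriv a b u \<in> L2 {a..b} \<and> is_weak_deriv a b u (weak_deriv a b u)"
    unfolding weak_deriv_def using g w
      someI[of "\<lambda>g. g \<in> L2 {a..b} \<and> is_weak_deriv a b u g" g] by blast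
  then show *: "weak_deriv a b u \<in> L2 {a..b}" "is_weak_deriv a b u (weak_deriv a b u)" by auto
  show "ae_eq a b (weak_deriv a b u) g"
    by (rule weak_deriv_unique[OF L2_integrable[OF *(1)] L2_integrable[OF g] *(2) w ab])
qed

text \<open>
  An equality, not only one almost everywhere: both sides choose from the same set of functions.
\<close>

lemma weak_deriv_ae_cong: "ae_eq a b u u' \<Longrightarrow> weak_deriv a b u = weak_deriv a b u'"
  unfolding weak_deriv_def using is_weak_deriv_ae_eq[OF _ ae_eq_refl] by auto


section \<open>Sobolev functions\<close>

lemma dds_0 [simp]: "dds a b 0 u = u"
  by (simp add: dds_def)

lemma dds_Suc: "dds a b (Suc k) u = weak_deriv a b (dds a b k u)"
  by (simp add: dds_def)

lemma dds_Suc': "dds a b (Suc k) u = dds a b k (weak_deriv a b u)"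
  by (simp add: dds_def funpow_swap1)

lemma dds_ae_eq: "ae_eq a b u u' \<Longrightarrow> ae_eq a b (dds a b k u) (dds a b k u')"
  by (cases k) (simp_all add: dds_Suc' weak_deriv_ae_cong)

text \<open>
  A chosen weak derivative is hard to compute with. A whole sequence of successive weak
  derivatives determines the chosen ones almost everywhere.
\<close>

definition weak_chain :: "real \<Rightarrow> real \<Rightarrow> nat \<Rightarrow> (nat \<Rightarrow> real \<Rightarrow> real) \<Rightarrow> bool" where
  "weak_chain a b N g \<longleftrightarrow>
     (\<forall>k\<le>N. g k \<in> L2 {a..b}) \<and> (\<forall>k<N. is_weak_deriv a b (g k) (g (Suc k)))"

lemma weak_chain_dds_ae_eq:
  assumes g: "weak_chain a b N g" and u: "ae_eq a b u (g 0)" and ab: "a < b" and k: "k \<le> N"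
  shows "ae_eq a b (dds a b k u) (g k)"
  using k
proof (induction k)
  case 0
  then show ?case using u by simp
next
  case (Suc k)
  then have "is_weak_deriv a b (dds a b k u) (g (Suc k))"
    using g is_weak_deriv_ae_eq[OF Suc.IH ae_eq_refl[of a b "g (Suc k)"]] by (simp add: weak_chain_def)
  moreover have "g (Suc k) \<in> L2 {a..b}" using g Suc by (simp add: weak_chain_def)
  ultimately show ?case unfolding dds_Suc using weak_deriv_eqI(3) ab by blast
qed

lemma weak_chain_Sobolev:
  assumes g: "weak_chain a b N g" and u: "ae_eq a b u (g 0)" and ab: "a < b"
  shows "u \<in> Sobolev a b N"
proof -
  have "u \<in> L2 {a..b}" using L2_ae_eq[OF u] g by (simp add: weak_chain_def)
  moreover have "is_weak_deriv a b (dds a b k u) (g (Suc k))" "g (Suc k) \<in> L2 {a..b}" if "k < N" for k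
    using g that is_weak_deriv_ae_eq[OF weak_chain_dds_ae_eq[OF g u ab, of k] ae_eq_refl[of a b "g (Suc k)"]]
    by (auto simp: weak_chain_def)
  ultimately show ?thesis unfolding Sobolev_def by blast
qed

lemma Sobolev_weak_chain:
  assumes u: "u \<in> Sobolev a b N" and ab: "a < b"
  shows "weak_chain a b N (\<lambda>k. dds a b k u)"
proof -
  have *: "dds a b (Suc k) u \<in> L2 {a..b}" "is_weak_deriv a b (dds a b k u) (dds a b (Suc k) u)"
    if "k < N" for k
    unfolding dds_Suc using u that weak_deriv_eqI[OF _ _ ab] by (auto simp: Sobolev_def)
  have "dds a b k u \<in> L2 {a..b}" if "k \<le> N" for k
    using u *(1) that by (cases k) (auto simp: Sobolev_def)
  with * show ?thesis by (simp add: weak_chain_def)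
qed

lemma Sobolev_dds_L2: "u \<in> Sobolev a b N \<Longrightarrow> a < b \<Longrightarrow> k \<le> N \<Longrightarrow> dds a b k u \<in> L2 {a..b}"
  using Sobolev_weak_chain by (auto simp: weak_chain_def)

lemma Sobolev_ae_eq:
  assumes u: "u \<in> Sobolev a b N" and "ae_eq a b u u'" and ab: "a < b"
  shows "u' \<in> Sobolev a b N"
  using weak_chain_Sobolev[OF Sobolev_weak_chain[OF u ab] _ ab, of u'] ae_eq_sym[OF assms(2)] by simp

lemma weak_chain_lincomb:
  assumes g: "weak_chain a b N g" and h: "weak_chain a b N h"
  shows "weak_chain a b N (\<lambda>k x. c * g k x + d * h k x)"
  unfolding weak_chain_def
proof (intro conjI allI impI)
  show "(\<lambda>x. c * g k x + d * h k x) \<in> L2 {a..b}" if "k \<le> N" for k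
    using g h that by (intro L2_lincomb) (auto simp: weak_chain_def)
  show "is_weak_deriv a b (\<lambda>x. c * g k x + d * h k x) (\<lambda>x. c * g (Suc k) x + d * h (Suc k) x)"
    if "k < N" for k
    using g h that by (intro is_weak_deriv_lincomb L2_integrable) (auto simp: weak_chain_def)
qed

lemma Sobolev_lincomb:
  assumes "u \<in> Sobolev a b N" "u' \<in> Sobolev a b N" and ab: "a < b"
  shows "(\<lambda>x. c * u x + d * u' x) \<in> Sobolev a b N"
    and "k \<le> N \<Longrightarrow> ae_eq a b (dds a b k (\<lambda>x. c * u x + d * u' x)) (\<lambda>x. c * dds a b k u x + d * dds a b k u' x)"
proof -
  note * = weak_chain_lincomb[OF Sobolev_weak_chain[OF assms(1) ab] Sobolev_weak_chain[OF assms(2) ab], of c d]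
  show "(\<lambda>x. c * u x + d * u' x) \<in> Sobolev a b N"
    by (rule weak_chain_Sobolev[OF * _ ab]) simp
  show "k \<le> N \<Longrightarrow> ae_eq a b (dds a b k (\<lambda>x. c * u x + d * u' x)) (\<lambda>x. c * dds a b k u x + d * dds a b k u' x)"
    by (rule weak_chain_dds_ae_eq[OF * _ ab]) simp_all
qed

lemma Sobolev_continuous_rep:
  assumes u: "u \<in> Sobolev a b N" and ab: "a < b" and i: "i < N"
  shows "\<exists>g. continuous_on {a..b} g \<and> ae_eq a b (dds a b i u) g"
proof -
  note c = Sobolev_weak_chain[OF u ab]
  have L: "dds a b i u \<in> L2 {a..b}" "dds a b (Suc i) u \<in> L2 {a..b}"
    and w: "is_weak_deriv a b (dds a b i u) (dds a b (Suc i) u)"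
    using c i by (auto simp: weak_chain_def)
  obtain r where "ae_eq a b (dds a b i u) (\<lambda>x. r + primitive a (dds a b (Suc i) u) x)"
    using weak_deriv_imp_primitive[OF L2_integrable[OF L(1)] L2_integrable[OF L(2)] w ab] by blast
  moreover have "continuous_on {a..b} (\<lambda>x. r + primitive a (dds a b (Suc i) u) x)"
    by (intro continuous_intros continuous_primitive L2_integrable L)
  ultimately show ?thesis by blast
qed

lemma cont_rep_eq:
  assumes "continuous_on {a..b} g" "ae_eq a b f g" "a < b" "x \<in> {a..b}"
  shows "cont_rep a b f x = g x"
proof -
  have "continuous_on {a..b} (cont_rep a b f) \<and> ae_eq a b (cont_rep a b f) f"
    unfolding cont_rep_def using assms(1) ae_eq_sym[OF assms(2)]
      someI[of "\<lambda>g. continuous_on {a..b} g \<and> ae_eq a b g f" g] by blast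
  then show ?thesis
    using continuous_ae_eq_imp_eq[OF _ assms(1) ae_eq_trans[OF _ assms(2)] assms(3,4)] by blast
qed

lemma boundary_values_eq:
  assumes "\<And>i. i < N \<Longrightarrow> continuous_on {a..b} (g i)" "\<And>i. i < N \<Longrightarrow> ae_eq a b (dds a b i u) (g i)"
    and "a < b"
  shows "boundary_values a b N u = Matrix.vec (2 * N) (\<lambda>i. if i < N then g i a else g (i - N) b)"
  unfolding boundary_values_def
  using cont_rep_eq[OF assms(1,2,3)] assms(3) by (intro eq_vecI) auto

lemma boundary_values_lincomb:
  assumes u: "u \<in> Sobolev a b N" and u': "u' \<in> Sobolev a b N" and ab: "a < b"
  shows "boundary_values a b N (\<lambda>x. c * u x + d * u' x)
         = c \<cdot>\<^sub>v boundary_values a b N u + d \<cdot>\<^sub>v boundary_values a b N u'"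
proof -
  obtain g h where g: "\<And>i. i < N \<Longrightarrow> continuous_on {a..b} (g i)" "\<And>i. i < N \<Longrightarrow> ae_eq a b (dds a b i u) (g i)"
    and h: "\<And>i. i < N \<Longrightarrow> continuous_on {a..b} (h i)" "\<And>i. i < N \<Longrightarrow> ae_eq a b (dds a b i u') (h i)"
    using Sobolev_continuous_rep[OF u ab] Sobolev_continuous_rep[OF u' ab] by metis
  have 1: "continuous_on {a..b} (\<lambda>x. c * g i x + d * h i x)" if "i < N" for i
    using g(1) h(1) that by (intro continuous_intros) auto
  have 2: "ae_eq a b (dds a b i (\<lambda>x. c * u x + d * u' x)) (\<lambda>x. c * g i x + d * h i x)" if "i < N" for i
    using ae_eq_trans[OF Sobolev_lincomb(2)[OF u u' ab, of i] ae_eq_lift2[OF g(2) h(2), of i i "\<lambda>_ y z. c * y + d * z"]] that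
    by simp
  have "boundary_values a b N (\<lambda>x. c * u x + d * u' x)
      = Matrix.vec (2 * N) (\<lambda>i. if i < N then c * g i a + d * h i a else c * g (i - N) b + d * h (i - N) b)"
    by (rule boundary_values_eq[OF 1 2 ab])
  also have "\<dots> = c \<cdot>\<^sub>v boundary_values a b N u + d \<cdot>\<^sub>v boundary_values a b N u'"
  proof -
    have "boundary_values a b N u = Matrix.vec (2 * N) (\<lambda>i. if i < N then g i a else g (i - N) b)"
      by (rule boundary_values_eq[OF g ab])
    moreover have "boundary_values a b N u' = Matrix.vec (2 * N) (\<lambda>i. if i < N then h i a else h (i - N) b)"
      by (rule boundary_values_eq[OF h ab])
    ultimately show ?thesis by (simp only:) (intro eq_vecI, auto)
  qed
  finally show ?thesis .
qed

lemma boundary_values_dim [simp]: "boundary_values a b N u \<in> carrier_vec (2 * N)"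
  by (simp add: boundary_values_def)

lemma boundary_values_ae_eq:
  assumes "ae_eq a b u u'"
  shows "boundary_values a b N u = boundary_values a b N u'"
proof -
  have "cont_rep a b (dds a b i u) = cont_rep a b (dds a b i u')" for i
  proof -
    have "ae_eq a b g (dds a b i u) \<longleftrightarrow> ae_eq a b g (dds a b i u')" for g
      using dds_ae_eq[OF assms, of i] by (meson ae_eq_sym ae_eq_trans)
    then show ?thesis by (simp add: cont_rep_def)
  qed
  then show ?thesis by (simp add: boundary_values_def cong: if_cong)
qed

lemma bc_space_lincomb:
  assumes u: "u \<in> bc_space a b N B" and u': "u' \<in> bc_space a b N B"
    and ab: "a < b" and B: "B \<in> carrier_mat N (2 * N)"
  shows "(\<lambda>x. c * u x + d * u' x) \<in> bc_space a b N B"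
proof -
  have S: "u \<in> Sobolev a b N" "u' \<in> Sobolev a b N" using u u' by (auto simp: bc_space_def)
  have "B *\<^sub>v (c \<cdot>\<^sub>v boundary_values a b N u + d \<cdot>\<^sub>v boundary_values a b N u')
      = c \<cdot>\<^sub>v (B *\<^sub>v boundary_values a b N u) + d \<cdot>\<^sub>v (B *\<^sub>v boundary_values a b N u')"
    using B by (simp add: mult_add_distrib_mat_vec[of B N "2 * N"] mult_mat_vec[of B N "2 * N"])
  also have "\<dots> = 0\<^sub>v N" using u u' by (intro eq_vecI) (simp_all add: bc_space_def)
  finally show ?thesis
    using Sobolev_lincomb(1)[OF S ab] boundary_values_lincomb[OF S ab] by (simp add: bc_space_def)
qed

lemma bc_space_ae_eq:
  assumes "u \<in> bc_space a b N B" "ae_eq a b u u'" "a < b"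
  shows "u' \<in> bc_space a b N B"
  using assms Sobolev_ae_eq[of u a b N u'] boundary_values_ae_eq[OF assms(2)] by (simp add: bc_space_def)

text \<open>
  Each integration turns a polynomial into a polynomial of one degree more plus a constant.
\<close>

lemma Sobolev_top_deriv_0_imp_poly:
  assumes "u \<in> Sobolev a b N" "ae_eq a b (dds a b N u) (\<lambda>_. 0)" and ab: "a < b"
  shows "\<exists>c. ae_eq a b u (\<lambda>x. \<Sum>k<N. c k * x ^ k)"
  using assms(1,2)
proof (induction N arbitrary: u)
  case 0
  then show ?case by simp
next
  case (Suc N)
  let ?u' = "weak_deriv a b u"
  note chain = Sobolev_weak_chain[OF Suc.prems(1) ab]
  have "weak_chain a b N (\<lambda>k. dds a b k ?u')"
    using chain by (auto simp: weak_chain_def simp flip: dds_Suc')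
  then have "?u' \<in> Sobolev a b N" using weak_chain_Sobolev ab by fastforce
  then obtain c where c: "ae_eq a b ?u' (\<lambda>x. \<Sum>k<N. c k * x ^ k)"
    using Suc.IH Suc.prems(2) by (auto simp: dds_Suc')
  have L: "u \<in> L2 {a..b}" "?u' \<in> L2 {a..b}" and w: "is_weak_deriv a b u ?u'"
    using chain by (auto simp: weak_chain_def dds_Suc dest: spec[of _ 0] spec[of _ "Suc 0"])
  obtain r where r: "ae_eq a b u (\<lambda>x. r + primitive a ?u' x)"
    using weak_deriv_imp_primitive[OF L2_integrable[OF L(1)] L2_integrable[OF L(2)] w ab] by blast
  define F where "F x = (\<Sum>k<N. c k / Suc k * x ^ Suc k)" for x
  have F: "(F has_real_derivative (\<Sum>k<N. c k * x ^ k)) (at x within {a..b})" for x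
    unfolding F_def
  proof (rule DERIV_sum)
    fix k
    show "((\<lambda>x. c k / Suc k * x ^ Suc k) has_real_derivative c k * x ^ k) (at x within {a..b})"
      using DERIV_cmult[OF DERIV_pow[of "Suc k" x "{a..b}"], of "c k / Suc k"] by simp
  qed
  have P: "primitive a ?u' x = F x - F a" if "x \<in> {a..b}" for x
    using primitive_ae_eq[OF c, of x] primitive_FTC[OF F _ that] that
    by (simp add: continuous_intros)
  (* the coefficients of the antiderivative, with the constant of integration in place 0 *)
  define c' where "c' k = (case k of 0 \<Rightarrow> r - F a | Suc j \<Rightarrow> c j / Suc j)" for k
  have "(\<Sum>k<Suc N. c' k * x ^ k) = r + (F x - F a)" for x
    unfolding sum.lessThan_Suc_shift by (simp add: c'_def F_def)
  then have "ae_eq a b (\<lambda>x. r + primitive a ?u' x) (\<lambda>x. \<Sum>k<Suc N. c' k * x ^ k)"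
    by (intro ae_eqI) (simp add: P)
  with r show ?case using ae_eq_trans by blast
qed



section \<open>Inverting the highest derivative under the boundary conditions\<close>

text \<open>
  The difference of the two functions satisfies the boundary conditions and is a polynomial of
  degree less than \<open>N\<close>, so it vanishes by well-posedness.
\<close>

lemma bc_space_unique:
  assumes u: "u \<in> bc_space a b N B" and u': "u' \<in> bc_space a b N B"
    and eq: "ae_eq a b (dds a b N u) (dds a b N u')"
    and ab: "a < b" and N: "0 < N" and B: "B \<in> carrier_mat N (2 * N)" and wp: "well_posed a b N B"
  shows "ae_eq a b u u'"
proof -
  let ?d = "\<lambda>x. 1 * u x + (-1) * u' x"
  have S: "u \<in> Sobolev a b N" "u' \<in> Sobolev a b N" using u u' by (auto simp: bc_space_def)
  have d: "?d \<in> bc_space a b N B" by (rule bc_space_lincomb[OF u u' ab B])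
  have "ae_eq a b (dds a b N ?d) (\<lambda>x. 1 * dds a b N u x + (-1) * dds a b N u' x)"
    by (rule Sobolev_lincomb(2)[OF S ab]) simp
  also have "ae_eq a b \<dots> (\<lambda>x. 0)"
    using ae_eq_lift2[OF eq ae_eq_refl[of a b "dds a b N u'"], of "\<lambda>_ y z. 1 * y + (-1) * z"] by simp
  finally obtain c where c: "ae_eq a b ?d (\<lambda>x. \<Sum>k<N. c k * x ^ k)"
    using Sobolev_top_deriv_0_imp_poly[OF _ _ ab, of ?d N] d by (auto simp: bc_space_def)
  define p where "p = (\<Sum>k<N. monom (c k) k)"
  have p: "poly p = (\<lambda>x. \<Sum>k<N. c k * x ^ k)"
    by (auto simp: p_def poly_sum poly_monom)
  have "degree p \<le> N - 1"
    unfolding p_def using N by (intro degree_sum_le) (auto intro: order.trans[OF degree_monom_le])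
  moreover have "poly p \<in> bc_space a b N B"
    unfolding p by (rule bc_space_ae_eq[OF d c ab])
  ultimately have "p = 0" using wp by (auto simp: well_posed_def)
  then have "poly p = (\<lambda>x. 0)" by auto
  then have "(\<lambda>x. \<Sum>k<N. c k * x ^ k) = (\<lambda>x. 0)" using p by simp
  then have "ae_eq a b ?d (\<lambda>x. 0)" using c by simp
  from ae_eq_lift2[OF this ae_eq_refl[of a b u'], of "\<lambda>_ y z. y + z"] show ?thesis by simp
qed

lemma is_weak_deriv_classical:
  assumes F: "\<And>x. (F has_real_derivative f x) (at x)" and f: "continuous_on {a..b} f"
  shows "is_weak_deriv a b F f"
proof -
  have "ae_eq a b F (\<lambda>x. F a + primitive a f x)"
    using primitive_FTC[OF DERIV_subset[OF F] f] by (intro ae_eqI) auto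
  from is_weak_deriv_ae_eq[OF this ae_eq_refl] show ?thesis
    using is_weak_deriv_primitive[OF L2_integrable[OF L2_continuous[OF f]]] by auto
qed

definition monom_deriv :: "nat \<Rightarrow> nat \<Rightarrow> real \<Rightarrow> real" where
  "monom_deriv i k x = poly ((pderiv ^^ i) (monom 1 k)) x"

lemma monom_deriv_0 [simp]: "monom_deriv 0 k x = x ^ k"
  by (simp add: monom_deriv_def poly_monom)

lemma DERIV_monom_deriv: "(monom_deriv i k has_real_derivative monom_deriv (Suc i) k x) (at x)"
  unfolding monom_deriv_def[abs_def] by (simp add: poly_DERIV)

lemma continuous_monom_deriv: "continuous_on S (monom_deriv i k)"
  by (meson DERIV_monom_deriv DERIV_isCont continuous_at_imp_continuous_on)

lemma pderiv_funpow_eq_0: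
  fixes p :: "real poly"
  shows "degree p < i \<Longrightarrow> (pderiv ^^ i) p = 0"
proof (induction i arbitrary: p)
  case (Suc i)
  have 0: "(pderiv ^^ j) (0 :: real poly) = 0" for j by (induction j) auto
  show ?case
  proof (cases "degree p = 0")
    case True
    then have "pderiv p = 0" by (simp add: pderiv_eq_0_iff)
    then show ?thesis by (simp add: funpow_Suc_right 0 del: funpow.simps(2))
  next
    case False
    then have "(pderiv ^^ i) (pderiv p) = 0" using Suc by (simp add: degree_pderiv)
    then show ?thesis by (simp add: funpow_Suc_right del: funpow.simps(2))
  qed
qed simp

lemma monom_deriv_eq_0: "k < N \<Longrightarrow> monom_deriv N k x = 0"
  using pderiv_funpow_eq_0[of "monom 1 k" N] by (simp add: monom_deriv_def degree_monom_eq)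

lemma weak_chain_poly: "weak_chain a b N (\<lambda>i x. \<Sum>k<M. c k * monom_deriv i k x)"
proof -
  have cont: "continuous_on {a..b} (\<lambda>x. \<Sum>k<M. c k * monom_deriv i k x)" for i
    by (intro continuous_intros continuous_monom_deriv)
  have "is_weak_deriv a b (\<lambda>x. \<Sum>k<M. c k * monom_deriv i k x) (\<lambda>x. \<Sum>k<M. c k * monom_deriv (Suc i) k x)" for i
    by (intro is_weak_deriv_classical cont DERIV_sum DERIV_cmult DERIV_monom_deriv)
  with L2_continuous[OF cont] show ?thesis by (simp add: weak_chain_def)
qed

definition iterated_primitive :: "real \<Rightarrow> nat \<Rightarrow> (real \<Rightarrow> real) \<Rightarrow> real \<Rightarrow> real" where
  "iterated_primitive a m v = (primitive a ^^ m) v"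

lemma iterated_primitive_0 [simp]: "iterated_primitive a 0 v = v"
  by (simp add: iterated_primitive_def)

lemma iterated_primitive_Suc: "iterated_primitive a (Suc m) v = primitive a (iterated_primitive a m v)"
  by (simp add: iterated_primitive_def)

lemma iterated_primitive_L2:
  assumes v: "v \<in> L2 {a..b}" shows "iterated_primitive a m v \<in> L2 {a..b}"
proof (induction m)
  case (Suc m)
  then show ?case
    unfolding iterated_primitive_Suc
    by (intro L2_continuous[OF continuous_primitive[OF L2_integrable]]) auto
qed (simp add: v)

lemma iterated_primitive_continuous:
  assumes v: "v \<in> L2 {a..b}" shows "continuous_on {a..b} (iterated_primitive a (Suc m) v)"
  unfolding iterated_primitive_Suc by (intro continuous_primitive L2_integrable iterated_primitive_L2 v)

lemma weak_chain_iterated_primitive: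
  assumes v: "v \<in> L2 {a..b}"
  shows "weak_chain a b N (\<lambda>i. iterated_primitive a (N - i) v)"
proof -
  have "is_weak_deriv a b (iterated_primitive a (Suc m) v) (iterated_primitive a m v)" for m
    using is_weak_deriv_primitive[OF L2_integrable[OF iterated_primitive_L2[OF v]], of 0 m]
    by (simp add: iterated_primitive_Suc)
  then have "is_weak_deriv a b (iterated_primitive a (N - i) v) (iterated_primitive a (N - Suc i) v)" if "i < N" for i
    using that by (metis Suc_diff_Suc)
  then show ?thesis using iterated_primitive_L2[OF v] by (simp add: weak_chain_def)
qed

text \<open>
  Cauchy's formula for repeated integration. Integration by parts moves one integral from \<open>v\<close> to the
  kernel: \<open>- (x - t)\<^sup>m\<^sup>+\<^sup>1 / (m + 1)!\<close> has the derivative \<open>(x - t)\<^sup>m / m!\<close> in \<open>t\<close>.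
\<close>

lemma iterated_primitive_formula:
  assumes v: "v \<in> L2 {a..b}" and x: "x \<in> {a..b}"
  shows "iterated_primitive a (Suc m) v x = primitive a (\<lambda>t. (x - t) ^ m / fact m * v t) x"
  using v
proof (induction m arbitrary: v)
  case 0
  then show ?case by (simp add: iterated_primitive_def)
next
  case (Suc m)
  define g G where "g t = (x - t) ^ m / fact m" and "G t = (x - t) ^ Suc m / fact (Suc m)" for t
  have v: "integrable (lebesgue_on {a..x}) v"
    using integrable_sub[OF L2_integrable[OF Suc.prems]] x by auto
  have gc: "continuous_on {a..x} g" "continuous_on {a..x} G" unfolding g_def G_def by (intro continuous_intros; simp)+
  have gi: "integrable (lebesgue_on {a..x}) g" by (rule L2_integrable[OF L2_continuous[OF gc(1)]]) simp
  have "((\<lambda>t. - G t) has_real_derivative g t) (at t within S)" for t S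
    unfolding G_def g_def
    by (rule derivative_eq_intros refl | simp del: of_nat_Suc)+
  then have G: "primitive a g t = G a - G t" if "t \<in> {a..x}" for t
    using primitive_FTC[of a x "\<lambda>t. - G t" g t] gc that by simp
  have Gx: "G x = 0" by (simp add: G_def)
  have pL2: "primitive a v \<in> L2 {a..b}"
    by (intro L2_continuous continuous_primitive L2_integrable Suc.prems) simp
  have i1: "integrable (lebesgue_on {a..x}) (\<lambda>t. v t * G t)"
    by (rule integrable_mult_continuous[OF v gc(2)])
  have i2: "integrable (lebesgue_on {a..x}) (\<lambda>t. g t * primitive a v t)"
    by (rule integrable_mult_continuous[OF gi continuous_primitive[OF v]])
  have "primitive a v x * G a = (LINT t|lebesgue_on {a..x}. v t * primitive a g t + g t * primitive a v t)"
    using primitive_mult[OF v gi] G[of x] Gx x by simp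
  also have "\<dots> = (LINT t|lebesgue_on {a..x}. G a * v t - v t * G t + g t * primitive a v t)"
    by (rule Bochner_Integration.integral_cong) (auto simp: G algebra_simps)
  also have "\<dots> = G a * primitive a v x - primitive a (\<lambda>t. v t * G t) x + primitive a (\<lambda>t. g t * primitive a v t) x"
  proof -
    have "primitive a w x = (LINT t|lebesgue_on {a..x}. w t)" for w by (simp add: primitive_def)
    then show ?thesis using v i1 i2 by simp
  qed
  finally have "primitive a (\<lambda>t. g t * primitive a v t) x = primitive a (\<lambda>t. v t * G t) x" by simp
  moreover have "iterated_primitive a (Suc (Suc m)) v x = primitive a (\<lambda>t. g t * primitive a v t) x"
    using Suc.IH[OF pL2] by (simp add: iterated_primitive_def funpow_swap1 g_def)
  ultimately show ?case by (simp add: G_def mult.commute)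
qed

text \<open>
  By well-posedness the square matrix that sends the coefficients of a polynomial of degree less
  than \<open>N\<close> to its boundary defect is injective, hence invertible. So a defect \<open>B (0, w)\<close> is
  removed by a polynomial whose coefficients depend linearly on \<open>w\<close>.
\<close>

lemma boundary_correction:
  assumes ab: "a < b" and N: "0 < N" and B: "B \<in> carrier_mat N (2 * N)" and wp: "well_posed a b N B"
  shows "\<exists>L. \<forall>w. B *\<^sub>v Matrix.vec (2 * N) (\<lambda>i.
      if i < N then \<Sum>k<N. (\<Sum>j<N. L k j * w j) * monom_deriv i k a
      else w (i - N) + (\<Sum>k<N. (\<Sum>j<N. L k j * w j) * monom_deriv (i - N) k b)) = 0\<^sub>v N"
proof -
  define D where "D i k = (if i < N then monom_deriv i k a else monom_deriv (i - N) k b)" for i k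
  define P where "P = Matrix.mat (2 * N) N (\<lambda>(i, k). D i k)"
  (* P maps coefficients to boundary values; E places w in the block of values at b *)
  define E where "E = Matrix.mat (2 * N) N (\<lambda>(i, j). if i = N + j then 1 else 0 :: real)"
  define M where "M = B * P"
  have P: "P \<in> carrier_mat (2 * N) N" and E: "E \<in> carrier_mat (2 * N) N" by (auto simp: P_def E_def)
  have M: "M \<in> carrier_mat N N" using B P by (auto simp: M_def)
  have Pv: "(P *\<^sub>v c) $ i = (\<Sum>k<N. c $ k * D i k)" if "c \<in> carrier_vec N" "i < 2 * N" for c i
    using that by (auto simp: P_def scalar_prod_def lessThan_atLeast0 mult.commute intro!: sum.cong)
  have "det M \<noteq> 0"
  proof
    assume "det M = 0"
    then obtain c where c: "c \<in> carrier_vec N" "c \<noteq> 0\<^sub>v N" "M *\<^sub>v c = 0\<^sub>v N"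
      using det_0_iff_vec_prod_zero_field[OF M] by blast
    define p where "p = (\<Sum>k<N. monom (c $ k) k)"
    have p: "poly p = (\<lambda>x. \<Sum>k<N. c $ k * monom_deriv 0 k x)"
      by (auto simp: p_def poly_sum poly_monom)
    note chain = weak_chain_poly[of a b N "\<lambda>k. c $ k" N]
    have ae0: "ae_eq a b (poly p) (\<lambda>x. \<Sum>k<N. c $ k * monom_deriv 0 k x)"
      using p by simp
    have "boundary_values a b N (poly p) = Matrix.vec (2 * N) (\<lambda>i. if i < N
        then \<Sum>k<N. c $ k * monom_deriv i k a else \<Sum>k<N. c $ k * monom_deriv (i - N) k b)"
    proof (rule boundary_values_eq[OF _ _ ab])
      show "continuous_on {a..b} (\<lambda>x. \<Sum>k<N. c $ k * monom_deriv i k x)" for i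
        by (intro continuous_intros continuous_monom_deriv)
      show "ae_eq a b (dds a b i (poly p)) (\<lambda>x. \<Sum>k<N. c $ k * monom_deriv i k x)" if "i < N" for i
        using weak_chain_dds_ae_eq[OF chain ae0 ab] that by simp
    qed
    also have "\<dots> = P *\<^sub>v c"
    proof (rule eq_vecI)
      fix i assume "i < dim_vec (P *\<^sub>v c)"
      then have "i < 2 * N" by (simp add: P_def)
      then show "Matrix.vec (2 * N) (\<lambda>i. if i < N
        then \<Sum>k<N. c $ k * monom_deriv i k a else \<Sum>k<N. c $ k * monom_deriv (i - N) k b) $ i = (P *\<^sub>v c) $ i"
        using Pv[OF c(1)] by (simp add: D_def)
    qed (simp add: P_def)
    finally have "B *\<^sub>v boundary_values a b N (poly p) = 0\<^sub>v N"
      using c B P by (simp add: M_def assoc_mult_mat_vec[of B N "2 * N" P N])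
    then have "poly p \<in> bc_space a b N B"
      using weak_chain_Sobolev[OF chain ae0 ab] by (simp add: bc_space_def)
    moreover have "degree p \<le> N - 1"
      unfolding p_def using N by (intro degree_sum_le) (auto intro: order.trans[OF degree_monom_le])
    ultimately have "p = 0" using wp by (auto simp: well_posed_def)
    have "c $ k = 0" if "k < N" for k
    proof -
      have "coeff p k = c $ k" unfolding p_def using that by (simp add: coeff_sum if_distrib sum.delta)
      then show ?thesis using \<open>p = 0\<close> by simp
    qed
    then have "c = 0\<^sub>v N" using c(1) by (intro eq_vecI) auto
    with c(2) show False by simp
  qed
  define Mi where "Mi = (1 / det M) \<cdot>\<^sub>m adj_mat M"
  have Mi: "Mi \<in> carrier_mat N N" using adj_mat(1)[OF M] by (simp add: Mi_def)
  have MMi: "M * Mi = 1\<^sub>m N"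
  proof -
    have "M * Mi = (1 / det M) \<cdot>\<^sub>m (det M \<cdot>\<^sub>m 1\<^sub>m N)"
      unfolding Mi_def by (subst mult_smult_distrib[OF M adj_mat(1)[OF M]]) (simp add: adj_mat(2)[OF M])
    also have "\<dots> = 1\<^sub>m N" using \<open>det M \<noteq> 0\<close> by (intro eq_matI) auto
    finally show ?thesis .
  qed
  define Lm where "Lm = - (Mi * (B * E))"
  have BE: "B * E \<in> carrier_mat N N" using B E by auto
  have Lm: "Lm \<in> carrier_mat N N" using Mi BE by (auto simp: Lm_def)
  show ?thesis
  proof (intro exI[of _ "\<lambda>k j. Lm $$ (k, j)"] allI)
    fix w :: "nat \<Rightarrow> real"
    define W where "W = Matrix.vec N w"
    have W: "W \<in> carrier_vec N" by (simp add: W_def)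
    have Lk: "(Lm *\<^sub>v W) $ k = (\<Sum>j<N. Lm $$ (k, j) * w j)" if "k < N" for k
      using that Lm by (auto simp: W_def scalar_prod_def lessThan_atLeast0 intro!: sum.cong)
    have c: "Lm *\<^sub>v W \<in> carrier_vec N" using Lm W by simp
    have "Matrix.vec (2 * N) (\<lambda>i.
        if i < N then \<Sum>k<N. (\<Sum>j<N. Lm $$ (k, j) * w j) * monom_deriv i k a
        else w (i - N) + (\<Sum>k<N. (\<Sum>j<N. Lm $$ (k, j) * w j) * monom_deriv (i - N) k b))
      = E *\<^sub>v W + P *\<^sub>v (Lm *\<^sub>v W)" (is "?lhs = _")
    proof (rule eq_vecI)
      fix i assume "i < dim_vec (E *\<^sub>v W + P *\<^sub>v (Lm *\<^sub>v W))"
      then have i: "i < 2 * N" by (simp add: P_def)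
      have "(E *\<^sub>v W) $ i = (\<Sum>j<N. if i = N + j then w j else 0)"
        using i by (auto simp: E_def W_def scalar_prod_def lessThan_atLeast0 intro!: sum.cong)
      also have "\<dots> = (\<Sum>j<N. if j = i - N then (if i < N then 0 else w j) else 0)"
        by (rule sum.cong) auto
      also have "\<dots> = (if i < N then 0 else w (i - N))" using i by (subst sum.delta) auto
      finally have "(E *\<^sub>v W) $ i = (if i < N then 0 else w (i - N))" .
      moreover have "(P *\<^sub>v (Lm *\<^sub>v W)) $ i = (\<Sum>k<N. (\<Sum>j<N. Lm $$ (k, j) * w j) * D i k)"
        unfolding Pv[OF c i] by (rule sum.cong) (auto simp: Lk)
      ultimately show "?lhs $ i = (E *\<^sub>v W + P *\<^sub>v (Lm *\<^sub>v W)) $ i"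
        using i P by (simp add: D_def)
    qed (simp add: P_def)
    also have "B *\<^sub>v (E *\<^sub>v W + P *\<^sub>v (Lm *\<^sub>v W)) = B *\<^sub>v (E *\<^sub>v W) + B *\<^sub>v (P *\<^sub>v (Lm *\<^sub>v W))"
      using E P W c by (intro mult_add_distrib_mat_vec[OF B]) auto
    also have "B *\<^sub>v (E *\<^sub>v W) = (B * E) *\<^sub>v W"
      by (rule assoc_mult_mat_vec[OF B E W, symmetric])
    also have "B *\<^sub>v (P *\<^sub>v (Lm *\<^sub>v W)) = (M * Lm) *\<^sub>v W"
      unfolding M_def assoc_mult_mat_vec[OF M[unfolded M_def] Lm W] by (rule assoc_mult_mat_vec[OF B P c, symmetric])
    also have "M * Lm = - (B * E)"
    proof -
      have "M * Lm = - (M * (Mi * (B * E)))"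
        unfolding Lm_def by (rule uminus_mult_right_mat) (use M Mi in auto)
      also have "M * (Mi * (B * E)) = B * E"
        unfolding assoc_mult_mat[OF M Mi BE, symmetric] MMi by (rule left_mult_one_mat[OF BE])
      finally show ?thesis .
    qed
    also have "- (B * E) *\<^sub>v W = - ((B * E) *\<^sub>v W)"
      by (rule uminus_mult_mat_vec) (use W E in auto)
    also have "(B * E) *\<^sub>v W + - ((B * E) *\<^sub>v W) = 0\<^sub>v N"
      by (rule uminus_r_inv_vec) (use BE W in auto)
    finally show "B *\<^sub>v ?lhs = 0\<^sub>v N" .
  qed
qed


text \<open>
  The \<open>N\<close>-fold integral of \<open>v\<close> and its derivatives of order less than \<open>N\<close> vanish at \<open>a\<close>, so its
  boundary defect involves only the values at \<open>b\<close>. The polynomial from \<open>boundary_correction\<close> removes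
  it and has vanishing \<open>N\<close>-th derivative; by uniqueness the sum is \<open>T v\<close>.
\<close>

lemma T_op_formula:
  assumes ab: "a < b" and N: "0 < N" and B: "B \<in> carrier_mat N (2 * N)" and wp: "well_posed a b N B"
  shows "\<exists>L. \<forall>v\<in>L2 {a..b}. T_op a b N B v \<in> bc_space a b N B \<and>
    (\<forall>i\<le>N. ae_eq a b (dds a b i (T_op a b N B v))
      (\<lambda>x. iterated_primitive a (N - i) v x
         + (\<Sum>k<N. (\<Sum>j<N. L k j * iterated_primitive a (N - j) v b) * monom_deriv i k x)))"
proof -
  obtain L where L: "\<And>w. B *\<^sub>v Matrix.vec (2 * N) (\<lambda>i.
      if i < N then \<Sum>k<N. (\<Sum>j<N. L k j * w j) * monom_deriv i k a
      else w (i - N) + (\<Sum>k<N. (\<Sum>j<N. L k j * w j) * monom_deriv (i - N) k b)) = 0\<^sub>v N"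
    using boundary_correction[OF ab N B wp] by blast
  have "T_op a b N B v \<in> bc_space a b N B \<and> (\<forall>i\<le>N. ae_eq a b (dds a b i (T_op a b N B v))
      (\<lambda>x. iterated_primitive a (N - i) v x
         + (\<Sum>k<N. (\<Sum>j<N. L k j * iterated_primitive a (N - j) v b) * monom_deriv i k x)))"
    if v: "v \<in> L2 {a..b}" for v
  proof -
    define w where "w j = iterated_primitive a (N - j) v b" for j
    define c where "c k = (\<Sum>j<N. L k j * w j)" for k
    define g where "g i x = 1 * iterated_primitive a (N - i) v x + 1 * (\<Sum>k<N. c k * monom_deriv i k x)" for i x
    have chain: "weak_chain a b N g"
      unfolding g_def by (intro weak_chain_lincomb weak_chain_iterated_primitive weak_chain_poly v)
    have g0: "ae_eq a b (g 0) (g 0)" by simp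
    note dds_g = weak_chain_dds_ae_eq[OF chain g0 ab]
    have cont: "continuous_on {a..b} (g i)" if i: "i < N" for i
    proof -
      obtain m where "N - i = Suc m" using i by (cases "N - i") auto
      then show ?thesis
        unfolding g_def by (auto intro!: continuous_intros iterated_primitive_continuous[OF v] continuous_monom_deriv)
    qed
    have "iterated_primitive a (N - i) v a = 0" if "i < N" for i
      using that by (cases "N - i") (auto simp: iterated_primitive_Suc)
    moreover have "boundary_values a b N (g 0) = Matrix.vec (2 * N) (\<lambda>i. if i < N then g i a else g (i - N) b)"
      by (rule boundary_values_eq[OF cont dds_g ab]) auto
    ultimately have "boundary_values a b N (g 0) = Matrix.vec (2 * N) (\<lambda>i.
      if i < N then \<Sum>k<N. (\<Sum>j<N. L k j * w j) * monom_deriv i k a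
      else w (i - N) + (\<Sum>k<N. (\<Sum>j<N. L k j * w j) * monom_deriv (i - N) k b))"
      by (simp only:) (intro eq_vecI, auto simp: g_def w_def c_def)
    then have bc: "g 0 \<in> bc_space a b N B"
      using L[of w] weak_chain_Sobolev[OF chain g0 ab] by (simp add: bc_space_def)
    have top: "g N = v" by (simp add: g_def monom_deriv_eq_0 fun_eq_iff)
    have top': "ae_eq a b (dds a b N (g 0)) v" using dds_g[of N] top by simp
    then have T: "T_op a b N B v \<in> bc_space a b N B \<and> ae_eq a b (dds a b N (T_op a b N B v)) v"
      unfolding T_op_def using bc
        someI[of "\<lambda>u. u \<in> bc_space a b N B \<and> ae_eq a b (dds a b N u) v" "g 0"] by blast
    have "ae_eq a b (T_op a b N B v) (g 0)"
      by (rule bc_space_unique[OF conjunct1[OF T] bc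
            ae_eq_trans[OF conjunct2[OF T] ae_eq_sym[OF top']] ab N B wp])
    then have "ae_eq a b (dds a b i (T_op a b N B v)) (g i)" if "i \<le> N" for i
      using ae_eq_trans[OF dds_ae_eq dds_g[OF that]] by blast
    moreover have "g i = (\<lambda>x. iterated_primitive a (N - i) v x
         + (\<Sum>k<N. (\<Sum>j<N. L k j * iterated_primitive a (N - j) v b) * monom_deriv i k x))" for i
      by (simp add: fun_eq_iff g_def c_def w_def)
    ultimately show ?thesis using T by simp
  qed
  then show ?thesis by blast
qed

lemma T_op_inverse:
  assumes "a < b" "0 < N" "B \<in> carrier_mat N (2 * N)" "well_posed a b N B" and v: "v \<in> L2 {a..b}"
  shows "T_op a b N B v \<in> bc_space a b N B" "ae_eq a b (dds a b N (T_op a b N B v)) v"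
proof -
  obtain L where "\<forall>v\<in>L2 {a..b}. T_op a b N B v \<in> bc_space a b N B \<and>
    (\<forall>i\<le>N. ae_eq a b (dds a b i (T_op a b N B v))
      (\<lambda>x. iterated_primitive a (N - i) v x
         + (\<Sum>k<N. (\<Sum>j<N. L k j * iterated_primitive a (N - j) v b) * monom_deriv i k x)))"
    using T_op_formula[OF assms(1-4)] by blast
  with v have T: "T_op a b N B v \<in> bc_space a b N B"
    and L: "ae_eq a b (dds a b N (T_op a b N B v))
      (\<lambda>x. iterated_primitive a (N - N) v x
         + (\<Sum>k<N. (\<Sum>j<N. L k j * iterated_primitive a (N - j) v b) * monom_deriv N k x))"
    by blast+
  show "T_op a b N B v \<in> bc_space a b N B" by (rule T)
  show "ae_eq a b (dds a b N (T_op a b N B v)) v" using L by (simp add: monom_deriv_eq_0)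
qed

lemma T_op_ae_cong: "ae_eq a b v v' \<Longrightarrow> T_op a b N B v = T_op a b N B v'"
  unfolding T_op_def by (rule arg_cong[of _ _ Eps]) (meson ae_eq_sym ae_eq_trans)

lemma T_op_lincomb:
  assumes S: "a < b" "0 < N" "B \<in> carrier_mat N (2 * N)" "well_posed a b N B"
    and v: "v \<in> L2 {a..b}" and w: "w \<in> L2 {a..b}"
  shows "ae_eq a b (T_op a b N B (\<lambda>x. c * v x + d * w x)) (\<lambda>x. c * T_op a b N B v x + d * T_op a b N B w x)"
proof (rule bc_space_unique[OF _ _ _ S])
  let ?T = "T_op a b N B"
  note v' = T_op_inverse[OF S v] and w' = T_op_inverse[OF S w] and vw' = T_op_inverse[OF S L2_lincomb[OF v w]]
  show "?T (\<lambda>x. c * v x + d * w x) \<in> bc_space a b N B" by (rule vw'(1))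
  show "(\<lambda>x. c * ?T v x + d * ?T w x) \<in> bc_space a b N B"
    by (rule bc_space_lincomb[OF v'(1) w'(1) S(1,3)])
  have "ae_eq a b (dds a b N (\<lambda>x. c * ?T v x + d * ?T w x)) (\<lambda>x. c * dds a b N (?T v) x + d * dds a b N (?T w) x)"
    using v'(1) w'(1) S(1) by (intro Sobolev_lincomb(2)[where N = N]) (auto simp: bc_space_def)
  also have "ae_eq a b \<dots> (\<lambda>x. c * v x + d * w x)"
    by (rule ae_eq_lift2[OF v'(2) w'(2), of "\<lambda>_ y z. c * y + d * z"])
  finally show "ae_eq a b (dds a b N (?T (\<lambda>x. c * v x + d * w x))) (dds a b N (\<lambda>x. c * ?T v x + d * ?T w x))"
    using vw'(2) ae_eq_sym ae_eq_trans by blast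
qed

text \<open>
  Cauchy's formula writes both the iterated integral and the values at \<open>b\<close> as integrals of \<open>v\<close>. The
  polynomial part integrates over all of \<open>[a, b]\<close> and so contributes the same term to both kernels.
\<close>

lemma dds_T_op_kernels:
  assumes S: "a < b" "0 < N" "B \<in> carrier_mat N (2 * N)" "well_posed a b N B" and i: "i < N"
  obtains K1 K2 where "continuous_on UNIV K1" "continuous_on UNIV K2"
    and "\<And>v. v \<in> L2 {a..b} \<Longrightarrow> ae_eq a b (dds a b i (T_op a b N B v)) (pi3_op a b (\<lambda>_. 0) K1 K2 v)"
proof -
  obtain L where "\<forall>v\<in>L2 {a..b}. T_op a b N B v \<in> bc_space a b N B \<and>
    (\<forall>i\<le>N. ae_eq a b (dds a b i (T_op a b N B v))
      (\<lambda>x. iterated_primitive a (N - i) v x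
         + (\<Sum>k<N. (\<Sum>j<N. L k j * iterated_primitive a (N - j) v b) * monom_deriv i k x)))"
    using T_op_formula[OF S] by blast
  with i have L: "ae_eq a b (dds a b i (T_op a b N B v))
      (\<lambda>x. iterated_primitive a (N - i) v x
         + (\<Sum>k<N. (\<Sum>j<N. L k j * iterated_primitive a (N - j) v b) * monom_deriv i k x))"
    if "v \<in> L2 {a..b}" for v using that less_imp_le by blast
  define E where "E m = (\<lambda>(x, t). (x - t) ^ m / fact m :: real)" for m
  define K2 where "K2 = (\<lambda>(x, t). \<Sum>k<N. \<Sum>j<N. L k j * monom_deriv i k x * E (N - 1 - j) (b, t))"
  define K1 where "K1 = (\<lambda>z. E (N - 1 - i) z + K2 z)"
  have E: "continuous_on UNIV (E m)" for m
    unfolding E_def case_prod_beta' by (intro continuous_intros) simp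
  have K2: "continuous_on UNIV K2"
    unfolding K2_def case_prod_beta'
    by (intro continuous_intros continuous_on_compose2[OF E] continuous_on_compose2[OF continuous_monom_deriv]) auto
  have K1: "continuous_on UNIV K1" unfolding K1_def by (intro continuous_intros E K2)
  have iter: "iterated_primitive a (N - j) v x = (LINT t|lebesgue_on {a..x}. E (N - 1 - j) (x, t) * v t)"
    if "v \<in> L2 {a..b}" "x \<in> {a..b}" "j < N" for v x j
  proof -
    have "N - j = Suc (N - 1 - j)" using that(3) by simp
    then show ?thesis
      using iterated_primitive_formula[OF that(1,2), of "N - 1 - j"] by (simp add: E_def primitive_def)
  qed
  have "ae_eq a b (dds a b i (T_op a b N B v)) (pi3_op a b (\<lambda>_. 0) K1 K2 v)" if v: "v \<in> L2 {a..b}" for v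
  proof (rule ae_eq_trans[OF L[OF v]])
    have int: "integrable (lebesgue_on {c..d}) (\<lambda>t. K (x, t) * v t)"
      if "continuous_on UNIV K" "a \<le> c" "d \<le> b" for K c d x
    proof -
      have "continuous_on {c..d} (\<lambda>t. K (x, t))"
        by (intro continuous_on_compose2[OF that(1)] continuous_intros) auto
      from integrable_mult_continuous[OF integrable_sub[OF L2_integrable[OF v] that(2,3)] this]
      show ?thesis by (simp add: mult.commute)
    qed
    have intb: "integrable (lebesgue_on {a..b}) (\<lambda>t. E m (b, t) * v t)" for m
      by (rule int[OF E]) auto
    show "ae_eq a b (\<lambda>x. iterated_primitive a (N - i) v x
         + (\<Sum>k<N. (\<Sum>j<N. L k j * iterated_primitive a (N - j) v b) * monom_deriv i k x))
       (pi3_op a b (\<lambda>_. 0) K1 K2 v)"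
    proof (rule ae_eqI)
      fix x assume x: "x \<in> {a..b}"
      have "pi3_op a b (\<lambda>_. 0) K1 K2 v x
          = (LINT t|lebesgue_on {a..x}. E (N - 1 - i) (x, t) * v t + K2 (x, t) * v t)
          + (LINT t|lebesgue_on {x..b}. K2 (x, t) * v t)"
        by (simp add: pi3_op_def K1_def distrib_right)
      also have "\<dots> = (LINT t|lebesgue_on {a..x}. E (N - 1 - i) (x, t) * v t)
          + ((LINT t|lebesgue_on {a..x}. K2 (x, t) * v t) + (LINT t|lebesgue_on {x..b}. K2 (x, t) * v t))"
        using int[OF E] int[OF K2] x by simp
      also have "(LINT t|lebesgue_on {a..x}. K2 (x, t) * v t) + (LINT t|lebesgue_on {x..b}. K2 (x, t) * v t)
          = (LINT t|lebesgue_on {a..b}. K2 (x, t) * v t)"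
        using int[OF K2, of a b x] x
        by (intro Equivalence_Measurable_On_Borel.integral_combine[symmetric]) auto
      also have "\<dots> = (LINT t|lebesgue_on {a..b}.
          (\<Sum>k<N. \<Sum>j<N. L k j * monom_deriv i k x * (E (N - 1 - j) (b, t) * v t)))"
        by (rule Bochner_Integration.integral_cong) (auto simp: K2_def sum_distrib_right mult.assoc)
      also have "\<dots> = (\<Sum>k<N. \<Sum>j<N. L k j * monom_deriv i k x * (LINT t|lebesgue_on {a..b}. E (N - 1 - j) (b, t) * v t))"
        using intb by (simp add: Bochner_Integration.integral_sum)
      also have "\<dots> = (\<Sum>k<N. (\<Sum>j<N. L k j * iterated_primitive a (N - j) v b) * monom_deriv i k x)"
        unfolding sum_distrib_right using S(1) by (intro sum.cong) (auto simp: iter[OF v])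
      finally show "iterated_primitive a (N - i) v x
         + (\<Sum>k<N. (\<Sum>j<N. L k j * iterated_primitive a (N - j) v b) * monom_deriv i k x)
         = pi3_op a b (\<lambda>_. 0) K1 K2 v x"
        using iter[OF v x i] by simp
    qed
  qed
  with K1 K2 show ?thesis by (rule that)
qed

text \<open>
  Bounded kernels give a pointwise bound by the \<open>L1\<close> norm of \<open>v\<close>, which its \<open>L2\<close> norm controls on a
  bounded interval.
\<close>

lemma pi2_continuous_kernels_bounded:
  assumes K: "continuous_on UNIV K1" "continuous_on UNIV K2" and ab: "a < b"
  obtains C where "\<And>v f. v \<in> L2 {a..b} \<Longrightarrow> f \<in> L2 {a..b} \<Longrightarrow> ae_eq a b f (pi3_op a b (\<lambda>_. 0) K1 K2 v)
     \<Longrightarrow> L2_norm a b f \<le> C * L2_norm a b v"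
proof -
  have "\<exists>M. \<forall>z\<in>{a..b} \<times> {a..b}. \<bar>K z\<bar> \<le> M" if "continuous_on UNIV K" for K :: "real \<times> real \<Rightarrow> real"
  proof -
    have "compact (K ` ({a..b} \<times> {a..b}))"
      by (intro compact_continuous_image continuous_on_subset[OF that] compact_Times) auto
    from compact_imp_bounded[OF this] show ?thesis unfolding bounded_iff by auto
  qed
  then obtain M1 M2 where M1: "\<And>z. z \<in> {a..b} \<times> {a..b} \<Longrightarrow> \<bar>K1 z\<bar> \<le> M1"
    and M2: "\<And>z. z \<in> {a..b} \<times> {a..b} \<Longrightarrow> \<bar>K2 z\<bar> \<le> M2"
    using K by meson
  define M where "M = max M1 M2"
  have M: "\<bar>K1 z\<bar> \<le> M" "\<bar>K2 z\<bar> \<le> M" if "z \<in> {a..b} \<times> {a..b}" for z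
    using M1[OF that] M2[OF that] by (auto simp: M_def)
  have M0: "0 \<le> M" using M(1)[of "(a, a)"] ab by simp
  have part: "\<bar>LINT t|lebesgue_on {c..d}. K (x, t) * v t\<bar> \<le> M * (LINT t|lebesgue_on {a..b}. \<bar>v t\<bar>)"
    if v: "v \<in> L2 {a..b}" and K: "\<And>z. z \<in> {a..b} \<times> {a..b} \<Longrightarrow> \<bar>K z\<bar> \<le> M"
      and x: "x \<in> {a..b}" "{c..d} \<subseteq> {a..b}" for K v c d x
  proof -
    have "\<bar>LINT t|lebesgue_on {c..d}. K (x, t) * v t\<bar> \<le> (LINT t|lebesgue_on {c..d}. \<bar>K (x, t) * v t\<bar>)"
      by (rule integral_abs_bound)
    also have "\<dots> \<le> (LINT t|lebesgue_on {a..b}. M * \<bar>v t\<bar>)"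
    proof (rule integral_mono_lebesgue_on_AE)
      show "integrable (lebesgue_on {a..b}) (\<lambda>t. M * \<bar>v t\<bar>)" using L2_integrable[OF v] by simp
      show "AE t in lebesgue_on {c..d}. \<bar>K (x, t) * v t\<bar> \<le> M * \<bar>v t\<bar>"
        using K x by (intro AE_I2) (auto simp: abs_mult intro!: mult_right_mono)
      show "AE t in lebesgue_on {a..b}. 0 \<le> M * \<bar>v t\<bar>" using M0 by simp
    qed (use x in auto)
    finally show ?thesis by simp
  qed
  show ?thesis
  proof (rule that)
    fix v f assume v: "v \<in> L2 {a..b}" and f: "f \<in> L2 {a..b}" "ae_eq a b f (pi3_op a b (\<lambda>_. 0) K1 K2 v)"
    define J where "J = (LINT t|lebesgue_on {a..b}. \<bar>v t\<bar>)"
    have J0: "0 \<le> J" by (simp add: J_def integral_nonneg_AE)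
    have bnd: "\<bar>pi3_op a b (\<lambda>_. 0) K1 K2 v x\<bar> \<le> 2 * M * J" if x: "x \<in> {a..b}" for x
    proof -
      have "\<bar>LINT t|lebesgue_on {a..x}. K1 (x, t) * v t\<bar> \<le> M * J"
        unfolding J_def using x by (intro part[OF v M(1)]) auto
      moreover have "\<bar>LINT t|lebesgue_on {x..b}. K2 (x, t) * v t\<bar> \<le> M * J"
        unfolding J_def using x by (intro part[OF v M(2)]) auto
      ultimately show ?thesis by (simp add: pi3_op_def)
    qed
    have "AE x in lebesgue_on {a..b}. \<bar>pi3_op a b (\<lambda>_. 0) K1 K2 v x\<bar> \<le> 2 * M * J"
      using bnd by (intro AE_I2) simp
    with f(2)[unfolded ae_eq_def] have "AE x in lebesgue_on {a..b}. \<bar>f x\<bar> \<le> 2 * M * J"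
      by eventually_elim simp
    then have "L2_norm a b f \<le> sqrt (b - a) * (2 * M * J)"
      using f(1) M0 J0 ab by (intro L2_norm_le_of_bound) auto
    also have "\<dots> \<le> sqrt (b - a) * (2 * M * (sqrt (b - a) * L2_norm a b v))"
      using L1_le_L2_norm[OF v ab] M0 ab by (intro mult_left_mono) (auto simp: J_def)
    finally show "L2_norm a b f \<le> (sqrt (b - a) * (2 * M * sqrt (b - a))) * L2_norm a b v"
      by (simp add: mult.assoc)
  qed
qed

lemma T_op_bounded:
  assumes S: "a < b" "0 < N" "B \<in> carrier_mat N (2 * N)" "well_posed a b N B"
  obtains C where "\<And>v. v \<in> L2 {a..b} \<Longrightarrow> Sobolev_norm a b N (T_op a b N B v) \<le> C * L2_norm a b v"
proof -
  have L2: "dds a b k (T_op a b N B v) \<in> L2 {a..b}" if "v \<in> L2 {a..b}" "k \<le> N" for v k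
    using Sobolev_dds_L2[of "T_op a b N B v" a b N k] T_op_inverse(1)[OF S that(1)] S that(2)
    by (simp add: bc_space_def)
  have "\<exists>C. \<forall>v\<in>L2 {a..b}. L2_norm a b (dds a b k (T_op a b N B v)) \<le> C * L2_norm a b v" if k: "k \<le> N" for k
  (* the top derivative of T v is v itself and has no integral representation *)
  proof (cases "k = N")
    case True
    then show ?thesis
      using L2_norm_ae_eq[OF T_op_inverse(2)[OF S]] by (intro exI[of _ 1]) simp
  next
    case False
    then have "k < N" using k by simp
    from dds_T_op_kernels[OF S this] obtain K1 K2 where K: "continuous_on UNIV K1" "continuous_on UNIV K2"
      "\<And>v. v \<in> L2 {a..b} \<Longrightarrow> ae_eq a b (dds a b k (T_op a b N B v)) (pi3_op a b (\<lambda>_. 0) K1 K2 v)"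
      by blast
    from pi2_continuous_kernels_bounded[OF K(1,2) S(1)] obtain C where
      "\<And>v f. v \<in> L2 {a..b} \<Longrightarrow> f \<in> L2 {a..b} \<Longrightarrow> ae_eq a b f (pi3_op a b (\<lambda>_. 0) K1 K2 v)
        \<Longrightarrow> L2_norm a b f \<le> C * L2_norm a b v" by blast
    then show ?thesis using K(3) L2 k by blast
  qed
  then obtain C where C: "\<And>k v. k \<le> N \<Longrightarrow> v \<in> L2 {a..b} \<Longrightarrow>
      L2_norm a b (dds a b k (T_op a b N B v)) \<le> C k * L2_norm a b v"
    by metis
  show ?thesis
  proof (rule that)
    fix v assume v: "v \<in> L2 {a..b}"
    have "Sobolev_norm a b N (T_op a b N B v) \<le> (\<Sum>k\<le>N. L2_norm a b (dds a b k (T_op a b N B v)))"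
      using L2_set_le_sum[of "{..N}" "\<lambda>k. L2_norm a b (dds a b k (T_op a b N B v))"]
      by (simp add: Sobolev_norm_def L2_set_def)
    also have "\<dots> \<le> (\<Sum>k\<le>N. C k * L2_norm a b v)" by (intro sum_mono C v) simp
    finally show "Sobolev_norm a b N (T_op a b N B v) \<le> (\<Sum>k\<le>N. C k) * L2_norm a b v"
      by (simp add: sum_distrib_right)
  qed
qed


section \<open>The tensor product on squares\<close>

text \<open>
  Lebesgue measure on the plane is only the completion of a product measure, so Fubini is applied to
  a Borel representative; almost all of its sections agree a.e. with those of \<open>R\<close>.
\<close>

lemma L2_square_sections:
  assumes R: "R \<in> L2 ({a..b} \<times> {a..b::real})"
  shows "AE s in lebesgue_on {a..b}. (\<lambda>t. R (s, t)) \<in> L2 {a..b}"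
proof -
  let ?S = "{a..b} \<times> {a..b}"
  have S: "?S \<in> sets lebesgue" by (simp add: borel_Times)
  define f where "f z = (if z \<in> ?S then R z else 0)" for z
  have "f \<in> borel_measurable lebesgue"
    unfolding f_def using R S by (intro borel_measurable_if_I) (auto simp: L2_def)
  then obtain f' where f'[measurable]: "f' \<in> borel_measurable lborel" and ff': "AE z in lborel. f z = f' z"
    using completion_ex_borel_measurable_real by blast
  have "integrable lebesgue (\<lambda>z. if z \<in> ?S then (R z)\<^sup>2 else 0)"
    using R S by (subst Lebesgue_Measure.integrable_restrict_UNIV) (auto simp: L2_def)
  moreover have "(\<lambda>z. if z \<in> ?S then (R z)\<^sup>2 else 0) = (\<lambda>z. (f z)\<^sup>2)" by (auto simp: f_def)
  ultimately have f2: "integrable lebesgue (\<lambda>z. (f z)\<^sup>2)" by simp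
  have f'm: "f' \<in> borel_measurable lebesgue" using f' by (rule measurable_completion)
  have "AE z in lebesgue. f z = f' z" using ff' by (rule AE_completion)
  then have "integrable lebesgue (\<lambda>z. (f' z)\<^sup>2)"
    using f2 f'm by (subst integrable_cong_AE[where g = "\<lambda>z. (f z)\<^sup>2"]) (auto elim: eventually_mono)
  then have f'2: "integrable (lborel \<Otimes>\<^sub>M lborel) (\<lambda>z. (f' z)\<^sup>2)"
    using f' by (subst (asm) integrable_completion) (auto simp: lborel_prod)
  have "AE s in lborel. AE t in lborel. f (s, t) = f' (s, t)"
    using ff' unfolding lborel_prod[symmetric] by (rule lborel_pair.AE_pair)
  moreover have "AE s in lborel. integrable lborel (\<lambda>t. (f' (s, t))\<^sup>2)"
    using lborel_pair.AE_integrable_fst'[OF f'2] by simp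
  ultimately have "AE s in lborel. s \<in> {a..b} \<longrightarrow> (\<lambda>t. R (s, t)) \<in> L2 {a..b}"
  proof eventually_elim
    case (elim s)
    show ?case
    proof
      assume s: "s \<in> {a..b}"
      have m: "(\<lambda>t. f' (s, t)) \<in> borel_measurable borel" by measurable
      have "(\<lambda>t. f' (s, t)) \<in> borel_measurable (lebesgue_on {a..b})"
        using m by (intro measurable_restrict_space1 measurable_completion) simp
      moreover have "integrable (lebesgue_on {a..b}) (\<lambda>t. (f' (s, t))\<^sup>2)"
      proof -
        have "integrable lebesgue (\<lambda>t. (f' (s, t))\<^sup>2)"
          using elim(2) m by (subst integrable_completion) auto
        then have "integrable lebesgue (\<lambda>t. indicator {a..b} t *\<^sub>R (f' (s, t))\<^sup>2)"
          by (intro integrable_mult_indicator) auto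
        then show ?thesis by (subst integrable_restrict_space) auto
      qed
      ultimately have "(\<lambda>t. f' (s, t)) \<in> L2 {a..b}" by (simp add: L2_def)
      moreover have "AE t in lebesgue. f (s, t) = f' (s, t)" using elim(1) by (rule AE_completion)
      then have "ae_eq a b (\<lambda>t. f' (s, t)) (\<lambda>t. R (s, t))"
        using s by (auto simp: ae_eq_def AE_restrict_space_iff f_def elim: eventually_mono)
      ultimately show "(\<lambda>t. R (s, t)) \<in> L2 {a..b}" using L2_ae_eq by blast
    qed
  qed
  then show ?thesis by (simp add: AE_restrict_space_iff AE_completion)
qed

text \<open>
  The symmetrised integrand over the triangle below the diagonal covers the whole square once, so
  this is \<open>primitive_mult\<close> read backwards.
\<close>

lemma triangle_integral:
  fixes v :: "real \<Rightarrow> real"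
  assumes A: "integrable (lebesgue_on {c..d}) (\<lambda>t. A t * v t)"
    and B: "integrable (lebesgue_on {c..d}) (\<lambda>t. B t * v t)"
  shows "(LINT \<theta>|lebesgue_on {c..d}. LINT \<eta>|lebesgue_on {c..\<theta>}. (A \<theta> * B \<eta> + A \<eta> * B \<theta>) * (v \<theta> * v \<eta>))
    = (LINT t|lebesgue_on {c..d}. A t * v t) * (LINT t|lebesgue_on {c..d}. B t * v t)"
proof -
  have "(LINT \<eta>|lebesgue_on {c..\<theta>}. (A \<theta> * B \<eta> + A \<eta> * B \<theta>) * (v \<theta> * v \<eta>))
      = (A \<theta> * v \<theta>) * primitive c (\<lambda>t. B t * v t) \<theta> + (B \<theta> * v \<theta>) * primitive c (\<lambda>t. A t * v t) \<theta>"
    if "\<theta> \<in> {c..d}" for \<theta>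
  proof -
    have "(LINT \<eta>|lebesgue_on {c..\<theta>}. (A \<theta> * B \<eta> + A \<eta> * B \<theta>) * (v \<theta> * v \<eta>))
        = (LINT \<eta>|lebesgue_on {c..\<theta>}. (A \<theta> * v \<theta>) * (B \<eta> * v \<eta>) + (B \<theta> * v \<theta>) * (A \<eta> * v \<eta>))"
      by (rule Bochner_Integration.integral_cong) (auto simp: algebra_simps)
    also have "\<dots> = (LINT \<eta>|lebesgue_on {c..\<theta>}. (A \<theta> * v \<theta>) * (B \<eta> * v \<eta>))
        + (LINT \<eta>|lebesgue_on {c..\<theta>}. (B \<theta> * v \<theta>) * (A \<eta> * v \<eta>))"
      using integrable_sub[OF A, of c \<theta>] integrable_sub[OF B, of c \<theta>] that
      by (intro Bochner_Integration.integral_add integrable_mult_right) auto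
    finally show ?thesis by (simp add: primitive_def)
  qed
  then have "(LINT \<theta>|lebesgue_on {c..d}. LINT \<eta>|lebesgue_on {c..\<theta>}. (A \<theta> * B \<eta> + A \<eta> * B \<theta>) * (v \<theta> * v \<eta>))
    = (LINT \<theta>|lebesgue_on {c..d}. (A \<theta> * v \<theta>) * primitive c (\<lambda>t. B t * v t) \<theta>
        + (B \<theta> * v \<theta>) * primitive c (\<lambda>t. A t * v t) \<theta>)"
    by (intro Bochner_Integration.integral_cong) auto
  then show ?thesis unfolding primitive_mult[OF A B] by (simp add: primitive_def)
qed

lemma rectangle_integral:
  fixes v :: "real \<Rightarrow> real"
  assumes A: "integrable (lebesgue_on I) (\<lambda>t. A t * v t)" "integrable (lebesgue_on J) (\<lambda>t. A' t * v t)"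
    and B: "integrable (lebesgue_on I) (\<lambda>t. B t * v t)" "integrable (lebesgue_on J) (\<lambda>t. B' t * v t)"
  shows "(LINT \<theta>|lebesgue_on J. LINT \<eta>|lebesgue_on I. (A' \<theta> * B \<eta> + A \<eta> * B' \<theta>) * (v \<theta> * v \<eta>))
    = (LINT t|lebesgue_on J. A' t * v t) * (LINT t|lebesgue_on I. B t * v t)
    + (LINT t|lebesgue_on J. B' t * v t) * (LINT t|lebesgue_on I. A t * v t)"
proof -
  let ?P = "LINT t|lebesgue_on I. A t * v t" and ?Q = "LINT t|lebesgue_on I. B t * v t"
  have "(LINT \<eta>|lebesgue_on I. (A' \<theta> * B \<eta> + A \<eta> * B' \<theta>) * (v \<theta> * v \<eta>))
      = (A' \<theta> * v \<theta>) * ?Q + (B' \<theta> * v \<theta>) * ?P" for \<theta>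
  proof -
    have "(LINT \<eta>|lebesgue_on I. (A' \<theta> * B \<eta> + A \<eta> * B' \<theta>) * (v \<theta> * v \<eta>))
        = (LINT \<eta>|lebesgue_on I. (A' \<theta> * v \<theta>) * (B \<eta> * v \<eta>) + (B' \<theta> * v \<theta>) * (A \<eta> * v \<eta>))"
      by (rule Bochner_Integration.integral_cong) (auto simp: algebra_simps)
    also have "\<dots> = (LINT \<eta>|lebesgue_on I. (A' \<theta> * v \<theta>) * (B \<eta> * v \<eta>))
        + (LINT \<eta>|lebesgue_on I. (B' \<theta> * v \<theta>) * (A \<eta> * v \<eta>))"
      by (intro Bochner_Integration.integral_add integrable_mult_right A B)
    finally show ?thesis by simp
  qed
  then have "(LINT \<theta>|lebesgue_on J. LINT \<eta>|lebesgue_on I. (A' \<theta> * B \<eta> + A \<eta> * B' \<theta>) * (v \<theta> * v \<eta>))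
      = (LINT \<theta>|lebesgue_on J. (A' \<theta> * v \<theta>) * ?Q + (B' \<theta> * v \<theta>) * ?P)" by simp
  also have "\<dots> = (LINT \<theta>|lebesgue_on J. (A' \<theta> * v \<theta>) * ?Q) + (LINT \<theta>|lebesgue_on J. (B' \<theta> * v \<theta>) * ?P)"
    by (intro Bochner_Integration.integral_add integrable_mult_left A B)
  finally show ?thesis by simp
qed

lemma pi2_kernels:
  assumes "has_pi2_kernels a b R K1 K2"
  shows "has_pi2_kernels a b R (fst (pi2_kernels a b R)) (snd (pi2_kernels a b R))"
  using someI[of "\<lambda>(R1, R2). has_pi2_kernels a b R R1 R2" "(K1, K2)"] assms
  by (simp add: pi2_kernels_def case_prod_beta')

text \<open>
  With \<open>s\<close> fixed, write the factors as \<open>P\<^sub>1 + P\<^sub>2\<close> and \<open>Q\<^sub>1 + Q\<^sub>2\<close>, the integrals over \<open>[a, s]\<close> and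
  \<open>[s, b]\<close>. The three terms of the tensor product are \<open>P\<^sub>1 Q\<^sub>1\<close>, \<open>P\<^sub>2 Q\<^sub>1 + Q\<^sub>2 P\<^sub>1\<close> and \<open>P\<^sub>2 Q\<^sub>2\<close>.
\<close>

lemma tensor_op_tensor_sq:
  assumes S: "has_pi2_kernels a b S K1 K2" and R: "has_pi2_kernels a b R K1' K2'" and v: "v \<in> L2 {a..b}"
  shows "ae_eq a b (tensor_op a b S R (tensor_sq v)) (\<lambda>s. S v s * R v s)"
proof -
  define S1 S2 R1 R2 where "S1 = fst (pi2_kernels a b S)" and "S2 = snd (pi2_kernels a b S)"
    and "R1 = fst (pi2_kernels a b R)" and "R2 = snd (pi2_kernels a b R)"
  have S: "has_pi2_kernels a b S S1 S2" and R: "has_pi2_kernels a b R R1 R2"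
    using pi2_kernels[OF S] pi2_kernels[OF R] by (simp_all add: S1_def S2_def R1_def R2_def)
  have "AE s in lebesgue_on {a..b}. (\<lambda>t. S1 (s, t)) \<in> L2 {a..b}" "AE s in lebesgue_on {a..b}. (\<lambda>t. S2 (s, t)) \<in> L2 {a..b}"
    "AE s in lebesgue_on {a..b}. (\<lambda>t. R1 (s, t)) \<in> L2 {a..b}" "AE s in lebesgue_on {a..b}. (\<lambda>t. R2 (s, t)) \<in> L2 {a..b}"
    using S R by (auto simp: has_pi2_kernels_def intro!: L2_square_sections)
  moreover have "AE s in lebesgue_on {a..b}. S v s = pi3_op a b (\<lambda>_. 0) S1 S2 v s"
    "AE s in lebesgue_on {a..b}. R v s = pi3_op a b (\<lambda>_. 0) R1 R2 v s"
    using S R v by (auto simp: has_pi2_kernels_def ae_eq_def)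
  moreover have "AE s in lebesgue_on {a..b}. s \<in> {a..b}" by (rule AE_I2) simp
  ultimately have "AE s in lebesgue_on {a..b}. tensor_op a b S R (tensor_sq v) s = S v s * R v s"
  proof eventually_elim
    case (elim s)
    have int: "integrable (lebesgue_on {a..s}) (\<lambda>t. K (s, t) * v t)"
      "integrable (lebesgue_on {s..b}) (\<lambda>t. K (s, t) * v t)"
      if "(\<lambda>t. K (s, t)) \<in> L2 {a..b}" for K
      using integrable_sub[OF L2_mult_integrable[OF that v]] elim(7) by auto
    note i = int[OF elim(1)] int[OF elim(2)] int[OF elim(3)] int[OF elim(4)]
    have "tensor_op a b S R (tensor_sq v) s =
        (LINT \<theta>|lebesgue_on {a..s}. LINT \<eta>|lebesgue_on {a..\<theta>}.
          (S1 (s, \<theta>) * R1 (s, \<eta>) + S1 (s, \<eta>) * R1 (s, \<theta>)) * (v \<theta> * v \<eta>))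
      + (LINT \<theta>|lebesgue_on {s..b}. LINT \<eta>|lebesgue_on {a..s}.
          (S2 (s, \<theta>) * R1 (s, \<eta>) + S1 (s, \<eta>) * R2 (s, \<theta>)) * (v \<theta> * v \<eta>))
      + (LINT \<theta>|lebesgue_on {s..b}. LINT \<eta>|lebesgue_on {s..\<theta>}.
          (S2 (s, \<theta>) * R2 (s, \<eta>) + S2 (s, \<eta>) * R2 (s, \<theta>)) * (v \<theta> * v \<eta>))"
      by (simp add: tensor_op_def pi22_op_def tensor_sq_def case_prod_beta' S1_def S2_def R1_def R2_def Let_def)
    also have "\<dots> = pi3_op a b (\<lambda>_. 0) S1 S2 v s * pi3_op a b (\<lambda>_. 0) R1 R2 v s"
      unfolding triangle_integral[OF i(1,5)] triangle_integral[OF i(4,8)] rectangle_integral[OF i(1,4,5,8)]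
      by (simp add: pi3_op_def algebra_simps)
    finally show ?case using elim(5,6) by simp
  qed
  then show ?thesis by (simp add: ae_eq_def)
qed


section \<open>Frechet derivatives of curves\<close>

lemma L2_norm_le_Sobolev_norm: "k \<le> N \<Longrightarrow> L2_norm a b (dds a b k u) \<le> Sobolev_norm a b N u"
  unfolding Sobolev_norm_def
  by (intro real_le_rsqrt member_le_sum) auto

lemma Sobolev_norm_ae_eq: "ae_eq a b u u' \<Longrightarrow> Sobolev_norm a b N u = Sobolev_norm a b N u'"
  unfolding Sobolev_norm_def using L2_norm_ae_eq[OF dds_ae_eq] by simp

lemma Sobolev_norm_nonneg: "0 \<le> Sobolev_norm a b N u"
  by (simp add: Sobolev_norm_def sum_nonneg)

text \<open>
  How a Frechet derivative is carried from one space of curves to another: the remainders only have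
  to be comparable at nonnegative times.
\<close>

lemma has_frechet_deriv_transfer:
  assumes f: "has_frechet_deriv X nrm f w t" and w': "w' \<in> X'"
    and nonneg: "\<And>u. 0 \<le> nrm' u"
    and le: "\<And>\<tau>. 0 \<le> \<tau> \<Longrightarrow> nrm' (\<lambda>s. f' \<tau> s - f' t s - (\<tau> - t) * w' s)
      \<le> C * nrm (\<lambda>s. f \<tau> s - f t s - (\<tau> - t) * w s)"
  shows "has_frechet_deriv X' nrm' f' w' t"
proof -
  let ?r = "\<lambda>\<tau>. nrm (\<lambda>s. f \<tau> s - f t s - (\<tau> - t) * w s)"
  let ?r' = "\<lambda>\<tau>. nrm' (\<lambda>s. f' \<tau> s - f' t s - (\<tau> - t) * w' s)"
  have "((\<lambda>\<tau>. C * (?r \<tau> / \<bar>\<tau> - t\<bar>)) \<longlongrightarrow> C * 0) (at t within {0..})"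
    using f by (intro tendsto_mult tendsto_const) (simp add: has_frechet_deriv_def)
  then have lim: "((\<lambda>\<tau>. C * (?r \<tau> / \<bar>\<tau> - t\<bar>)) \<longlongrightarrow> 0) (at t within {0..})" by simp
  have "((\<lambda>\<tau>. ?r' \<tau> / \<bar>\<tau> - t\<bar>) \<longlongrightarrow> 0) (at t within {0..})"
  proof (rule tendsto_sandwich[OF _ _ tendsto_const lim])
    show "\<forall>\<^sub>F \<tau> in at t within {0..}. 0 \<le> ?r' \<tau> / \<bar>\<tau> - t\<bar>"
      using nonneg by (intro always_eventually) simp
    have "?r' \<tau> / \<bar>\<tau> - t\<bar> \<le> C * (?r \<tau> / \<bar>\<tau> - t\<bar>)" if "0 \<le> \<tau>" for \<tau>
      using divide_right_mono[OF le[OF that] abs_ge_zero[of "\<tau> - t"]] by simp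
    then show "\<forall>\<^sub>F \<tau> in at t within {0..}. ?r' \<tau> / \<bar>\<tau> - t\<bar> \<le> C * (?r \<tau> / \<bar>\<tau> - t\<bar>)"
      by (auto simp: eventually_at_filter)
  qed
  with w' show ?thesis by (simp add: has_frechet_deriv_def)
qed

text \<open>
  The difference of the two remainders is \<open>(\<tau> - t) (w - w')\<close> up to sign; dividing by \<open>\<tau> - t\<close> shows
  that the norm of \<open>w - w'\<close> is bounded by quantities that tend to 0.
\<close>

lemma has_frechet_deriv_L2_unique:
  assumes f: "\<And>\<tau>. 0 \<le> \<tau> \<Longrightarrow> f \<tau> \<in> L2 {a..b}" and t: "0 \<le> t"
    and w: "has_frechet_deriv (L2 {a..b}) (L2_norm a b) f w t"
    and w': "has_frechet_deriv (L2 {a..b}) (L2_norm a b) f w' t"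
  shows "ae_eq a b w w'"
proof -
  let ?d = "\<lambda>s. w s - w' s"
  let ?r = "\<lambda>w \<tau> s. f \<tau> s - f t s - (\<tau> - t) * w s"
  have L: "w \<in> L2 {a..b}" "w' \<in> L2 {a..b}" using w w' by (auto simp: has_frechet_deriv_def)
  have "((\<lambda>\<tau>. 2 * (L2_norm a b (?r w' \<tau>) / \<bar>\<tau> - t\<bar>) + 2 * (L2_norm a b (?r w \<tau>) / \<bar>\<tau> - t\<bar>)) \<longlongrightarrow> 2 * 0 + 2 * 0)
      (at t within {0..})"
    using w w' unfolding has_frechet_deriv_def by (intro tendsto_add tendsto_mult tendsto_const) auto
  moreover have "\<forall>\<^sub>F \<tau> in at t within {0..}. L2_norm a b ?d
      \<le> 2 * (L2_norm a b (?r w' \<tau>) / \<bar>\<tau> - t\<bar>) + 2 * (L2_norm a b (?r w \<tau>) / \<bar>\<tau> - t\<bar>)"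
  proof -
    have "L2_norm a b ?d \<le> 2 * (L2_norm a b (?r w' \<tau>) / \<bar>\<tau> - t\<bar>) + 2 * (L2_norm a b (?r w \<tau>) / \<bar>\<tau> - t\<bar>)"
      if \<tau>: "0 \<le> \<tau>" "\<tau> \<noteq> t" for \<tau>
    proof -
      have "?r x \<tau> \<in> L2 {a..b}" if "x \<in> L2 {a..b}" for x
        by (intro L2_diff L2_cmult f \<tau> t that)
      then have "L2_norm a b (\<lambda>s. ?r w' \<tau> s - ?r w \<tau> s) \<le> 2 * L2_norm a b (?r w' \<tau>) + 2 * L2_norm a b (?r w \<tau>)"
        using L by (intro L2_norm_diff_le)
      moreover have "(\<lambda>s. ?r w' \<tau> s - ?r w \<tau> s) = (\<lambda>s. (\<tau> - t) * ?d s)"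
        by (auto simp: algebra_simps)
      ultimately have "\<bar>\<tau> - t\<bar> * L2_norm a b ?d \<le> 2 * L2_norm a b (?r w' \<tau>) + 2 * L2_norm a b (?r w \<tau>)"
        by (simp add: L2_norm_cmult)
      then have "L2_norm a b ?d \<le> (2 * L2_norm a b (?r w' \<tau>) + 2 * L2_norm a b (?r w \<tau>)) / \<bar>\<tau> - t\<bar>"
        using \<tau>(2) by (simp add: pos_le_divide_eq mult.commute)
      then show ?thesis by (simp add: add_divide_distrib)
    qed
    then show ?thesis by (auto simp: eventually_at_filter)
  qed
  moreover have "at t within {0..} \<noteq> bot"
  proof -
    have "at_right t \<le> at t within {0..}" using t by (intro at_le) auto
    then show ?thesis using trivial_limit_at_right_real[of t] by (metis bot.extremum_uniqueI)
  qed
  ultimately have "L2_norm a b ?d \<le> 2 * 0 + 2 * 0"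
    by (intro tendsto_lowerbound)
  then have "L2_norm a b ?d = 0" using L2_norm_nonneg[of a b ?d] by linarith
  then have "ae_eq a b ?d (\<lambda>_. 0)" using L2_norm_eq_0[OF L2_diff[OF L]] by simp
  from ae_eq_lift2[OF this ae_eq_refl[of a b w'], of "\<lambda>_ y z. y + z"] show ?thesis by simp
qed


section \<open>Equivalence of the PDE and the PIE\<close>

context
  fixes a b :: real and N :: nat and B :: "real mat"
  assumes S: "a < b" "0 < N" "B \<in> carrier_mat N (2 * N)" "well_posed a b N B"
begin

lemma T_op_Sobolev: "v \<in> L2 {a..b} \<Longrightarrow> T_op a b N B v \<in> Sobolev a b N"
  using T_op_inverse(1)[OF S] by (simp add: bc_space_def)

lemma T_op_L2: "v \<in> L2 {a..b} \<Longrightarrow> T_op a b N B v \<in> L2 {a..b}"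
  using T_op_Sobolev by (auto simp: Sobolev_def)

lemma T_op_dds:
  assumes "u \<in> bc_space a b N B"
  shows "dds a b N u \<in> L2 {a..b}" "ae_eq a b (T_op a b N B (dds a b N u)) u"
proof -
  show L: "dds a b N u \<in> L2 {a..b}"
    using assms S(1) by (intro Sobolev_dds_L2[of u a b N]) (auto simp: bc_space_def)
  show "ae_eq a b (T_op a b N B (dds a b N u)) u"
    by (rule bc_space_unique[OF T_op_inverse(1)[OF S L] assms T_op_inverse(2)[OF S L] S])
qed

lemma R_op_has_pi2_kernels:
  assumes i: "i < N"
  shows "\<exists>K1 K2. has_pi2_kernels a b (R_op a b N B i) K1 K2"
proof -
  obtain K1 K2 where K: "continuous_on UNIV K1" "continuous_on UNIV K2"
    and "\<And>v. v \<in> L2 {a..b} \<Longrightarrow> ae_eq a b (dds a b i (T_op a b N B v)) (pi3_op a b (\<lambda>_. 0) K1 K2 v)"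
    using dds_T_op_kernels[OF S i] by blast
  moreover have "K \<in> L2 ({a..b} \<times> {a..b})" if "continuous_on UNIV K" for K :: "real \<times> real \<Rightarrow> real"
    by (intro L2_continuous continuous_on_subset[OF that] compact_Times) auto
  ultimately have "has_pi2_kernels a b (R_op a b N B i) K1 K2"
    using i by (auto simp: has_pi2_kernels_def R_op_def)
  then show ?thesis by blast
qed

lemma pie_rhs_ae_eq_pde_rhs:
  assumes v: "v \<in> L2 {a..b}"
  shows "ae_eq a b (\<lambda>s. A_op a b N B \<alpha> v s + B_op a b N B \<beta> (tensor_sq v) s)
    (\<lambda>s. (\<Sum>i\<le>N. \<alpha> i s * dds a b i (T_op a b N B v) s)
       + (\<Sum>i<N. \<Sum>j\<le>i. \<beta> i j s * dds a b i (T_op a b N B v) s * dds a b j (T_op a b N B v) s))"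
proof (rule ae_eq_lift2[where h = "\<lambda>_ y z. y + z"])
  have "ae_eq a b (R_op a b N B i v) (dds a b i (T_op a b N B v))" if "i \<le> N" for i
    using that ae_eq_sym[OF T_op_inverse(2)[OF S v]] by (auto simp: R_op_def)
  then show "ae_eq a b (A_op a b N B \<alpha> v) (\<lambda>s. \<Sum>i\<le>N. \<alpha> i s * dds a b i (T_op a b N B v) s)"
    unfolding A_op_def mult_op_def by (intro ae_eq_sum ae_eq_lift[where h = "\<lambda>s y. \<alpha> i s * y" for i]) auto
  have "ae_eq a b (tensor_op a b (R_op a b N B i) (R_op a b N B j) (tensor_sq v))
      (\<lambda>s. dds a b i (T_op a b N B v) s * dds a b j (T_op a b N B v) s)" if "i < N" "j < N" for i j
    using that tensor_op_tensor_sq[OF _ _ v] R_op_has_pi2_kernels[OF that(1)] R_op_has_pi2_kernels[OF that(2)]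
    by (fastforce simp: R_op_def)
  then have "ae_eq a b (\<lambda>s. \<beta> i j s * tensor_op a b (R_op a b N B i) (R_op a b N B j) (tensor_sq v) s)
      (\<lambda>s. \<beta> i j s * dds a b i (T_op a b N B v) s * dds a b j (T_op a b N B v) s)" if "i < N" "j \<le> i" for i j
    using ae_eq_lift[where h = "\<lambda>s y. \<beta> i j s * y"] that by (simp add: mult.assoc)
  then show "ae_eq a b (B_op a b N B \<beta> (tensor_sq v))
      (\<lambda>s. \<Sum>i<N. \<Sum>j\<le>i. \<beta> i j s * dds a b i (T_op a b N B v) s * dds a b j (T_op a b N B v) s)"
    unfolding B_op_def mult_op_def by (intro ae_eq_sum) auto
qed

lemma T_op_remainder:
  assumes "x \<in> L2 {a..b}" "y \<in> L2 {a..b}" "w \<in> L2 {a..b}"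
  shows "ae_eq a b (T_op a b N B (\<lambda>s. x s - y s - r * w s)) (\<lambda>s. T_op a b N B x s - T_op a b N B y s - r * T_op a b N B w s)"
proof -
  have "ae_eq a b (T_op a b N B (\<lambda>s. 1 * (x s - y s) + (- r) * w s)) (\<lambda>s. 1 * T_op a b N B (\<lambda>s. x s - y s) s + (- r) * T_op a b N B w s)"
    by (intro T_op_lincomb S L2_diff assms)
  then have 1: "ae_eq a b (T_op a b N B (\<lambda>s. x s - y s - r * w s)) (\<lambda>s. T_op a b N B (\<lambda>s. x s - y s) s - r * T_op a b N B w s)"
    by simp
  have "ae_eq a b (T_op a b N B (\<lambda>s. 1 * x s + (- 1) * y s)) (\<lambda>s. 1 * T_op a b N B x s + (- 1) * T_op a b N B y s)"
    by (intro T_op_lincomb S assms)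
  from ae_eq_lift[OF this, of "\<lambda>s y. y - r * T_op a b N B w s"]
  have "ae_eq a b (\<lambda>s. T_op a b N B (\<lambda>s. x s - y s) s - r * T_op a b N B w s) (\<lambda>s. T_op a b N B x s - T_op a b N B y s - r * T_op a b N B w s)" by simp
  with 1 show ?thesis by (rule ae_eq_trans)
qed

lemma dds_remainder:
  assumes "x \<in> Sobolev a b N" "y \<in> Sobolev a b N" "w \<in> Sobolev a b N"
  shows "ae_eq a b (dds a b N (\<lambda>s. x s - y s - r * w s))
    (\<lambda>s. dds a b N x s - dds a b N y s - r * dds a b N w s)"
proof -
  have xy: "(\<lambda>s. 1 * x s + (- 1) * y s) \<in> Sobolev a b N"
    by (rule Sobolev_lincomb(1)[OF assms(1,2) S(1)])
  have "ae_eq a b (dds a b N (\<lambda>s. 1 * (1 * x s + (- 1) * y s) + (- r) * w s))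
      (\<lambda>s. 1 * dds a b N (\<lambda>s. 1 * x s + (- 1) * y s) s + (- r) * dds a b N w s)"
    by (rule Sobolev_lincomb(2)[OF xy assms(3) S(1)]) simp
  then have 1: "ae_eq a b (dds a b N (\<lambda>s. x s - y s - r * w s))
      (\<lambda>s. dds a b N (\<lambda>s. x s - y s) s - r * dds a b N w s)"
    by simp
  have "ae_eq a b (dds a b N (\<lambda>s. 1 * x s + (- 1) * y s))
      (\<lambda>s. 1 * dds a b N x s + (- 1) * dds a b N y s)"
    by (rule Sobolev_lincomb(2)[OF assms(1,2) S(1)]) simp
  from ae_eq_lift[OF this, of "\<lambda>s y. y - r * dds a b N w s"]
  have "ae_eq a b (\<lambda>s. dds a b N (\<lambda>s. x s - y s) s - r * dds a b N w s)
      (\<lambda>s. dds a b N x s - dds a b N y s - r * dds a b N w s)" by simp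
  with 1 show ?thesis by (rule ae_eq_trans)
qed

lemma Sobolev_frechet_imp_L2_frechet:
  assumes w: "has_frechet_deriv (Sobolev a b N) (Sobolev_norm a b N) u w t"
    and w': "ae_eq a b w w'"
  shows "has_frechet_deriv (L2 {a..b}) (L2_norm a b) u w' t"
proof (rule has_frechet_deriv_transfer[OF w, where C = 1])
  have "w \<in> L2 {a..b}" using w by (simp add: has_frechet_deriv_def Sobolev_def)
  then show "w' \<in> L2 {a..b}" using L2_ae_eq[OF w'] by simp
  show "L2_norm a b (\<lambda>s. u \<tau> s - u t s - (\<tau> - t) * w' s)
      \<le> 1 * Sobolev_norm a b N (\<lambda>s. u \<tau> s - u t s - (\<tau> - t) * w s)" for \<tau>
    using L2_norm_ae_eq[OF ae_eq_lift[OF w', of "\<lambda>s y. u \<tau> s - u t s - (\<tau> - t) * y"]]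
      L2_norm_le_Sobolev_norm[of 0 N a b "\<lambda>s. u \<tau> s - u t s - (\<tau> - t) * w s"] by simp
qed simp

text \<open>
  From the PIE to the PDE, \<open>T\<close> carries the derivative \<open>w\<close> of \<open>v\<close> to a derivative of \<open>T v\<close> in the
  Sobolev norm. It is also a derivative in the weaker \<open>L2\<close> norm, where the PIE already prescribes
  one, so uniqueness identifies the two. Conversely the Sobolev norm dominates the \<open>L2\<close> norms of
  both the function and its \<open>N\<close>-th derivative, so differentiability of \<open>T v\<close> there yields that of
  \<open>T v\<close> and of \<open>v\<close> in \<open>L2\<close>.
\<close>

lemma pie_solution_iff_pde_solution:
  assumes v0: "v0 \<in> L2 {a..b}" and v: "\<And>t. 0 \<le> t \<Longrightarrow> v t \<in> L2 {a..b}"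
  shows "pie_solution a b (T_op a b N B) (A_op a b N B \<alpha>) (B_op a b N B \<beta>) v v0
    \<longleftrightarrow> pde_solution a b N B \<alpha> \<beta> (\<lambda>t. T_op a b N B (v t)) (T_op a b N B v0)"
proof
  assume pie: "pie_solution a b (T_op a b N B) (A_op a b N B \<alpha>) (B_op a b N B \<beta>) v v0"
  show "pde_solution a b N B \<alpha> \<beta> (\<lambda>t. T_op a b N B (v t)) (T_op a b N B v0)"
    unfolding pde_solution_def
  proof (intro conjI allI impI)
    show "ae_eq a b (T_op a b N B (v 0)) (T_op a b N B v0)"
      using pie T_op_ae_cong[of a b "v 0" v0] by (simp add: pie_solution_def)
    fix t :: real assume t: "0 \<le> t"
    show "T_op a b N B (v t) \<in> bc_space a b N B" by (rule T_op_inverse(1)[OF S v[OF t]])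
    obtain w where w: "has_frechet_deriv (L2 {a..b}) (L2_norm a b) v w t"
      and Tw: "has_frechet_deriv (L2 {a..b}) (L2_norm a b) (\<lambda>\<tau>. T_op a b N B (v \<tau>))
         (\<lambda>s. A_op a b N B \<alpha> (v t) s + B_op a b N B \<beta> (tensor_sq (v t)) s) t"
      using pie t by (auto simp: pie_solution_def)
    have wL: "w \<in> L2 {a..b}" using w by (simp add: has_frechet_deriv_def)
    obtain C where C: "\<And>v. v \<in> L2 {a..b} \<Longrightarrow> Sobolev_norm a b N (T_op a b N B v) \<le> C * L2_norm a b v"
      using T_op_bounded[OF S] by blast
    have Sob: "has_frechet_deriv (Sobolev a b N) (Sobolev_norm a b N) (\<lambda>\<tau>. T_op a b N B (v \<tau>)) (T_op a b N B w) t"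
    proof (rule has_frechet_deriv_transfer[OF w])
      show "T_op a b N B w \<in> Sobolev a b N" by (rule T_op_Sobolev[OF wL])
      show "0 \<le> Sobolev_norm a b N u" for u by (rule Sobolev_norm_nonneg)
      fix \<tau> :: real assume \<tau>: "0 \<le> \<tau>"
      have "Sobolev_norm a b N (\<lambda>s. T_op a b N B (v \<tau>) s - T_op a b N B (v t) s - (\<tau> - t) * T_op a b N B w s)
          = Sobolev_norm a b N (T_op a b N B (\<lambda>s. v \<tau> s - v t s - (\<tau> - t) * w s))"
        by (rule Sobolev_norm_ae_eq[OF ae_eq_sym[OF T_op_remainder[OF v[OF \<tau>] v[OF t] wL]]])
      also have "\<dots> \<le> C * L2_norm a b (\<lambda>s. v \<tau> s - v t s - (\<tau> - t) * w s)"
        by (intro C L2_diff L2_cmult v \<tau> t wL)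
      finally show "Sobolev_norm a b N (\<lambda>s. T_op a b N B (v \<tau>) s - T_op a b N B (v t) s - (\<tau> - t) * T_op a b N B w s)
          \<le> C * L2_norm a b (\<lambda>s. v \<tau> s - v t s - (\<tau> - t) * w s)" .
    qed
    have "ae_eq a b (T_op a b N B w) (\<lambda>s. A_op a b N B \<alpha> (v t) s + B_op a b N B \<beta> (tensor_sq (v t)) s)"
      by (rule has_frechet_deriv_L2_unique[OF T_op_L2[OF v] t
            Sobolev_frechet_imp_L2_frechet[OF Sob ae_eq_refl] Tw])
    from ae_eq_trans[OF this pie_rhs_ae_eq_pde_rhs[OF v[OF t]]] Sob
    show "\<exists>w. has_frechet_deriv (Sobolev a b N) (Sobolev_norm a b N) (\<lambda>\<tau>. T_op a b N B (v \<tau>)) w t \<and>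
        ae_eq a b w (\<lambda>s. (\<Sum>i\<le>N. \<alpha> i s * dds a b i (T_op a b N B (v t)) s)
          + (\<Sum>i<N. \<Sum>j\<le>i. \<beta> i j s * dds a b i (T_op a b N B (v t)) s * dds a b j (T_op a b N B (v t)) s))"
      by blast
  qed
next
  assume pde: "pde_solution a b N B \<alpha> \<beta> (\<lambda>t. T_op a b N B (v t)) (T_op a b N B v0)"
  show "pie_solution a b (T_op a b N B) (A_op a b N B \<alpha>) (B_op a b N B \<beta>) v v0"
    unfolding pie_solution_def
  proof (intro conjI allI impI)
    have "ae_eq a b (T_op a b N B (v 0)) (T_op a b N B v0)" using pde by (simp add: pde_solution_def)
    then have "ae_eq a b (dds a b N (T_op a b N B (v 0))) (dds a b N (T_op a b N B v0))" by (rule dds_ae_eq)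
    with T_op_inverse(2)[OF S v[OF order_refl]] T_op_inverse(2)[OF S v0]
    show "ae_eq a b (v 0) v0" using ae_eq_sym ae_eq_trans by blast
    fix t :: real assume t: "0 \<le> t"
    show "v t \<in> L2 {a..b}" by (rule v[OF t])
    obtain w where w: "has_frechet_deriv (Sobolev a b N) (Sobolev_norm a b N) (\<lambda>\<tau>. T_op a b N B (v \<tau>)) w t"
      and rhs: "ae_eq a b w (\<lambda>s. (\<Sum>i\<le>N. \<alpha> i s * dds a b i (T_op a b N B (v t)) s)
          + (\<Sum>i<N. \<Sum>j\<le>i. \<beta> i j s * dds a b i (T_op a b N B (v t)) s * dds a b j (T_op a b N B (v t)) s))"
      using pde t by (auto simp: pde_solution_def)
    have wS: "w \<in> Sobolev a b N" using w by (simp add: has_frechet_deriv_def)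
    have "has_frechet_deriv (L2 {a..b}) (L2_norm a b) v (dds a b N w) t"
    proof (rule has_frechet_deriv_transfer[OF w, where C = 1])
      show "dds a b N w \<in> L2 {a..b}" by (rule Sobolev_dds_L2[OF wS S(1) order_refl])
      fix \<tau> :: real assume \<tau>: "0 \<le> \<tau>"
      have "ae_eq a b (\<lambda>s. dds a b N (T_op a b N B (v \<tau>)) s - dds a b N (T_op a b N B (v t)) s) (\<lambda>s. v \<tau> s - v t s)"
        by (rule ae_eq_lift2[OF T_op_inverse(2)[OF S v[OF \<tau>]] T_op_inverse(2)[OF S v[OF t]], of "\<lambda>_ y z. y - z"])
      from ae_eq_lift[OF this, of "\<lambda>s y. y - (\<tau> - t) * dds a b N w s"]
      have "ae_eq a b (dds a b N (\<lambda>s. T_op a b N B (v \<tau>) s - T_op a b N B (v t) s - (\<tau> - t) * w s))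
          (\<lambda>s. v \<tau> s - v t s - (\<tau> - t) * dds a b N w s)"
        by (rule ae_eq_trans[OF dds_remainder[OF T_op_Sobolev[OF v[OF \<tau>]] T_op_Sobolev[OF v[OF t]] wS]])
      from L2_norm_ae_eq[OF this]
      show "L2_norm a b (\<lambda>s. v \<tau> s - v t s - (\<tau> - t) * dds a b N w s)
          \<le> 1 * Sobolev_norm a b N (\<lambda>s. T_op a b N B (v \<tau>) s - T_op a b N B (v t) s - (\<tau> - t) * w s)"
        using L2_norm_le_Sobolev_norm[of N N a b "\<lambda>s. T_op a b N B (v \<tau>) s - T_op a b N B (v t) s - (\<tau> - t) * w s"] by simp
    qed simp
    then show "\<exists>w. has_frechet_deriv (L2 {a..b}) (L2_norm a b) v w t" by blast
    show "has_frechet_deriv (L2 {a..b}) (L2_norm a b) (\<lambda>\<tau>. T_op a b N B (v \<tau>))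
        (\<lambda>s. A_op a b N B \<alpha> (v t) s + B_op a b N B \<beta> (tensor_sq (v t)) s) t"
      by (rule Sobolev_frechet_imp_L2_frechet[OF w
            ae_eq_trans[OF rhs ae_eq_sym[OF pie_rhs_ae_eq_pde_rhs[OF v[OF t]]]]])
  qed
qed

lemma pde_solution_ae_cong:
  assumes pde: "pde_solution a b N B \<alpha> \<beta> u u0"
    and u: "\<And>t. 0 \<le> t \<Longrightarrow> ae_eq a b (u t) (u' t)" and u0: "ae_eq a b u0 u0'"
  shows "pde_solution a b N B \<alpha> \<beta> u' u0'"
  unfolding pde_solution_def
proof (intro conjI allI impI)
  have "ae_eq a b (u 0) u0" using pde by (simp add: pde_solution_def)
  with u[OF order_refl] u0 show "ae_eq a b (u' 0) u0'" using ae_eq_sym ae_eq_trans by blast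
  fix t :: real assume t: "0 \<le> t"
  obtain w where w: "has_frechet_deriv (Sobolev a b N) (Sobolev_norm a b N) u w t"
    and rhs: "ae_eq a b w (\<lambda>s. (\<Sum>i\<le>N. \<alpha> i s * dds a b i (u t) s)
        + (\<Sum>i<N. \<Sum>j\<le>i. \<beta> i j s * dds a b i (u t) s * dds a b j (u t) s))"
    and bc: "u t \<in> bc_space a b N B"
    using pde t by (auto simp: pde_solution_def)
  show "u' t \<in> bc_space a b N B" by (rule bc_space_ae_eq[OF bc u[OF t] S(1)])
  have "has_frechet_deriv (Sobolev a b N) (Sobolev_norm a b N) u' w t"
  proof (rule has_frechet_deriv_transfer[OF w _ Sobolev_norm_nonneg, where C = 1])
    show "w \<in> Sobolev a b N" using w by (simp add: has_frechet_deriv_def)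
    fix \<tau> :: real assume \<tau>: "0 \<le> \<tau>"
    show "Sobolev_norm a b N (\<lambda>s. u' \<tau> s - u' t s - (\<tau> - t) * w s)
        \<le> 1 * Sobolev_norm a b N (\<lambda>s. u \<tau> s - u t s - (\<tau> - t) * w s)"
      using Sobolev_norm_ae_eq[OF ae_eq_lift2[OF u[OF \<tau>] u[OF t], of "\<lambda>s y z. y - z - (\<tau> - t) * w s"]] by simp
  qed
  moreover have "ae_eq a b (\<lambda>s. (\<Sum>i\<le>N. \<alpha> i s * dds a b i (u t) s)
        + (\<Sum>i<N. \<Sum>j\<le>i. \<beta> i j s * dds a b i (u t) s * dds a b j (u t) s))
      (\<lambda>s. (\<Sum>i\<le>N. \<alpha> i s * dds a b i (u' t) s)
        + (\<Sum>i<N. \<Sum>j\<le>i. \<beta> i j s * dds a b i (u' t) s * dds a b j (u' t) s))"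
  proof -
    note d = dds_ae_eq[OF u[OF t]]
    have "ae_eq a b (\<lambda>s. \<Sum>i\<le>N. \<alpha> i s * dds a b i (u t) s) (\<lambda>s. \<Sum>i\<le>N. \<alpha> i s * dds a b i (u' t) s)"
      by (intro ae_eq_sum ae_eq_lift[OF d, where h = "\<lambda>s y. \<alpha> i s * y" for i])
    moreover have "ae_eq a b (\<lambda>s. \<Sum>i<N. \<Sum>j\<le>i. \<beta> i j s * dds a b i (u t) s * dds a b j (u t) s)
        (\<lambda>s. \<Sum>i<N. \<Sum>j\<le>i. \<beta> i j s * dds a b i (u' t) s * dds a b j (u' t) s)"
      by (intro ae_eq_sum ae_eq_lift2[OF d d, where h = "\<lambda>s y z. \<beta> i j s * y * z" for i j])
    ultimately show ?thesis by (rule ae_eq_lift2[where h = "\<lambda>_ y z. y + z"])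
  qed
  ultimately show "\<exists>w. has_frechet_deriv (Sobolev a b N) (Sobolev_norm a b N) u' w t \<and>
      ae_eq a b w (\<lambda>s. (\<Sum>i\<le>N. \<alpha> i s * dds a b i (u' t) s)
        + (\<Sum>i<N. \<Sum>j\<le>i. \<beta> i j s * dds a b i (u' t) s * dds a b j (u' t) s))"
    using ae_eq_trans[OF rhs] by blast
qed

text \<open>
  Every \<open>u\<close> that satisfies the boundary conditions is \<open>T\<close> of its \<open>N\<close>-th derivative a.e., and being a
  PDE solution depends only on the classes modulo null sets.
\<close>

lemma pde_solution_iff_pie_solution:
  assumes u0: "u0 \<in> bc_space a b N B" and u: "\<And>t. 0 \<le> t \<Longrightarrow> u t \<in> bc_space a b N B"
  shows "pde_solution a b N B \<alpha> \<beta> u u0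
    \<longleftrightarrow> pie_solution a b (T_op a b N B) (A_op a b N B \<alpha>) (B_op a b N B \<beta>) (\<lambda>t. dds a b N (u t)) (dds a b N u0)"
proof -
  note eq = T_op_dds(2)[OF u] and eq0 = T_op_dds(2)[OF u0]
  have "pde_solution a b N B \<alpha> \<beta> u u0
      \<longleftrightarrow> pde_solution a b N B \<alpha> \<beta> (\<lambda>t. T_op a b N B (dds a b N (u t))) (T_op a b N B (dds a b N u0))"
    by (rule iffI; erule pde_solution_ae_cong) (blast intro: eq eq0 ae_eq_sym)+
  also have "\<dots> \<longleftrightarrow> pie_solution a b (T_op a b N B) (A_op a b N B \<alpha>) (B_op a b N B \<beta>) (\<lambda>t. dds a b N (u t)) (dds a b N u0)"
    by (rule pie_solution_iff_pde_solution[symmetric, OF T_op_dds(1)[OF u0] T_op_dds(1)[OF u]])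
  finally show ?thesis .
qed

end

theorem lemma8:
  fixes a b :: real and N :: nat and B :: "real mat"
    and \<alpha> :: "nat \<Rightarrow> real \<Rightarrow> real" and \<beta> :: "nat \<Rightarrow> nat \<Rightarrow> real \<Rightarrow> real"
  assumes "a < b" and "0 < N"
    and "B \<in> carrier_mat N (2 * N)"
    and "well_posed a b N B"
    and "\<And>k. k \<le> N \<Longrightarrow> \<alpha> k \<in> Linf {a..b}"
    and "\<And>i j. i < N \<Longrightarrow> j \<le> i \<Longrightarrow> \<beta> i j \<in> Linf {a..b}"
  shows "(\<forall>v v0. v0 \<in> L2 {a..b} \<and> (\<forall>t\<ge>0. v t \<in> L2 {a..b}) \<longrightarrow>
           (pie_solution a b (T_op a b N B) (A_op a b N B \<alpha>) (B_op a b N B \<beta>) v v0 \<longleftrightarrow>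
            pde_solution a b N B \<alpha> \<beta> (\<lambda>t. T_op a b N B (v t)) (T_op a b N B v0))) \<and>
         (\<forall>u u0. u0 \<in> bc_space a b N B \<and> (\<forall>t\<ge>0. u t \<in> bc_space a b N B) \<longrightarrow>
           (pde_solution a b N B \<alpha> \<beta> u u0 \<longleftrightarrow>
            pie_solution a b (T_op a b N B) (A_op a b N B \<alpha>) (B_op a b N B \<beta>)
              (\<lambda>t. dds a b N (u t)) (dds a b N u0)))"
  using pie_solution_iff_pde_solution[OF assms(1-4)] pde_solution_iff_pie_solution[OF assms(1-4)]
  by (intro conjI allI impI) auto

end
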